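(* Let $M$ be a polynomial-time (deterministic) Turing machine that inputs and outputs bit strings from $\{0,1\}^*$. Then there exists a RaML program $M' : \{0,1\}^* \to \{0,1\}^*$ (a closed RaML expression of type $L(\mathbf 1+\mathbf 1)\to L(\mathbf 1+\mathbf 1)$, where bit strings are encoded as values of type $L(\mathbf 1+\mathbf 1)$) such that (1) for every input $w\in\{0,1\}^*$, $M(w)=M'(w)$; (2) for every input $w$, the computational cost of evaluating $M'$ on $w$ according to the tick metric is larger than or equal to the running time of $M$ on $w$; (3) univariate AARA can infer a polynomial upper bound of the computational cost of $M'$; that is, there are a finite vector $\vec q$ of non-negative rationals, a resource-annotated type $b'$ whose underlying simple type is $L(\mathbf 1+\mathbf 1)$, and $c,c'\in\mathbb Q_{\ge 0}$ such that $M'$ has the resource-annotated type $\langle L^{\vec q}(\mathbf 1+\mathbf 1),c\rangle\to\langle b',c'\rangle$ in univariate AARA for the tick metric.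
   Context: **Turing machines.** A Turing machine is a tuple $(Q,\Sigma,\Gamma,\vdash,\sqcup,\delta,q_0,q_{\text{final}})$: finite state set $Q$, finite input alphabet $\Sigma$ (here $\{0,1\}$), finite tape alphabet $\Gamma\supseteq\Sigma$, left end marker ${\vdash}\in\Gamma\setminus\Sigma$, blank $\sqcup\in\Gamma\setminus\Sigma$, $\delta:Q\times\Gamma\to Q\times\Gamma\times\{L,R\}$, $q_0,q_{\text{final}}\in Q$. The tape is semi-infinite with $\vdash$ at its left end (as usual, the machine never overwrites $\vdash$ or moves left of it). Initially the input $w$ is written right after $\vdash$, the rest is blank, the state is $q_0$ and the head is on the first cell after $\vdash$. At each step the machine applies $\delta$ to the current state and scanned symbol (new state, written symbol, head move). It terminates as soon as it enters $q_{\text{final}}$; the output $M(w)$ is then the tape content (after $\vdash$) before the first blank. The running time is the number of steps. $M$ is polynomial-time if its running time on $w$ is at most $p(|w|)$ for some polynomial $p:\mathbb N\to\mathbb N$. **RaML.** Base types: $b::=\mathbf 1\mid b_1+b_2\mid b_1\times b_2\mid L(b)$ (lists); simple types: $\tau::=b\mid b_1\to b_2$. Expressions (let-normal form): $x$; $\langle\,\rangle$; $\ell\cdot x$; $r\cdot x$; $\mathsf{case}\,x\,\{\ell\cdot y\hookrightarrow e_\ell\mid r\cdot y\hookrightarrow e_r\}$; $\langle x_1,x_2\rangle$; $\mathsf{case}\,x\,\{\langle x_1,x_2\rangle\hookrightarrow e\}$; $[\,]$; $x_1::x_2$; $\mathsf{case}\,x\,\{[\,]\hookrightarrow e_0\mid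 (x_1::x_2)\hookrightarrow e_1\}$; $\mathsf{fun}\,f\,x=e$ (recursive: $e$ may mention $f$); $f\,x$; $\mathsf{tick}\,q$ ($q\in\mathbb Q$); $\mathsf{let}\,x=e_1\,\mathsf{in}\,e_2$; $\mathsf{share}\,x\,\mathsf{as}\,x_1,x_2\,\mathsf{in}\,e$. Simple typing is standard and affine: each variable is used at most once, $\mathsf{share}$ duplicates a variable, weakening is allowed, $\mathsf{tick}\,q:\mathbf 1$. Evaluation is standard call-by-value. In the *tick metric*, the cost of an evaluation is the sum of all $q$ over executed expressions $\mathsf{tick}\,q$; everything else costs $0$. **Univariate AARA (tick metric).** Resource-annotated types: $b::=\mathbf 1\mid b_1+b_2\mid b_1\times b_2\mid L^{\vec q}(b)$ with $\vec q=(q_1,\dots,q_k)$ a finite vector over $\mathbb Q_{\ge0}$; $B::=\langle b,q\rangle$, $q\in\mathbb Q_{\ge0}$; $\tau::=b\mid B_1\to B_2$. The annotation $\vec q$ on a list of length $n$ stands for the potential $\sum_{i=1}^k q_i\binom ni$ (vectors may be padded by zeros); $0$ denotes the zero vector. Put $\lhd(\vec q)=(q_1+q_2,q_2+q_3,\dots,q_{k-1}+q_k,q_k)$. Judgments are $\Gamma;q\vdash e:\langle\tau,p\rangle$, with $q,p\in\mathbb Q_{\ge 0}$; unions of contexts are disjoint. Rules: - $x:\tau;0\vdash x:\langle\tau,0\rangle$; $\;\cdot;0\vdash\langle\,\rangle:\langle\mathbf 1,0\rangle$; $\;\cdot;q\vdash\mathsf{tick}\,q:\langle\mathbf 1,0\rangle$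 for $q\ge0$; $\;x:b_1;0\vdash\ell\cdot x:\langle b_1+b_2,0\rangle$ and symmetrically for $r$; $\;x_1:b_1,x_2:b_2;0\vdash\langle x_1,x_2\rangle:\langle b_1\times b_2,0\rangle$; $\;\cdot;0\vdash[\,]:\langle L^{\vec q}(b),0\rangle$; $\;x_1:b,x_2:L^{\lhd(\vec q)}(b);q_1\vdash x_1::x_2:\langle L^{\vec q}(b),0\rangle$. - Sum case: from $\Gamma,y:b_1;q\vdash e_\ell:B$ and $\Gamma,y:b_2;q\vdash e_r:B$ infer $\Gamma,x:b_1+b_2;q\vdash\mathsf{case}\,x\{\dots\}:B$. Product case: from $\Gamma,x_1:b_1,x_2:b_2;q\vdash e:B$ infer $\Gamma,x:b_1\times b_2;q\vdash\mathsf{case}\,x\{\langle x_1,x_2\rangle\hookrightarrow e\}:B$. List case: from $\Gamma;q\vdash e_0:B$ and $\Gamma,x_1:b,x_2:L^{\lhd(\vec p)}(b);q+p_1\vdash e_1:B$ infer $\Gamma,x:L^{\vec p}(b);q\vdash\mathsf{case}\,x\{\dots\}:B$. - Let: from $\Gamma_1;q\vdash e_1:\langle\tau,p\rangle$ and $\Gamma_2,x:\tau;p\vdash e_2:B$ infer $\Gamma_1\cup\Gamma_2;q\vdash\mathsf{let}\,x=e_1\,\mathsf{in}\,e_2:B$. - Share: if $\tau$ splits into $(\tau_1,\tau_2)$ and $\Gamma,x_1:\tau_1,x_2:\tau_2;q\vdash e:B$ then $\Gamma,x:\tau;q\vdash\mathsf{share}\,x\,\mathsf{as}\,x_1,x_2\,\mathsf{in}\,e:B$.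 Here the relation "splits into" on base types splits every list annotation as a sum, i.e. $L^{\vec p_1+\vec p_2}(b)$ splits into $(L^{\vec p_1}(b_1),L^{\vec p_2}(b_2))$ when $b$ splits into $(b_1,b_2)$, and is componentwise on $\mathbf 1,+,\times$; a function variable may be shared with any types from its set $\mathcal T$ (below). - Functions carry a set $\mathcal T$ of annotated arrow types with the same underlying simple type. If all annotations in the base types of $\Gamma$ are zero and, for every $(\langle b,q\rangle\to B_2)\in\mathcal T$, $\Gamma,f:\mathcal T,x:b;q\vdash e:B_2$, then $\Gamma;0\vdash\mathsf{fun}\,f\,x=e:\langle\mathcal T,0\rangle$; the function is then said to have each type in $\mathcal T$. Application: if $(\langle b,q\rangle\to B_2)\in\mathcal T$ then $f:\mathcal T,x:b;q\vdash f\,x:B_2$. So that inference terminates, the use of recursion is restricted: a recursive call inside the derivation of $B_1\to B_2$ for $f$ uses either $B_1\to B_2$ itself, or a type $C_1\to C_2$ such that $(C_1-B_1)\to(C_2-B_2)$ (annotation-wise difference) has strictly lower degree than $B_1\to B_2$ and $C_1\to C_2$ and is derivable for $f$ in the system where all costs (ticks) are $0$, with recursive calls there using only the type being derived. - Structural rules: weakening of $\Gamma$; subsumption on the result and, contravariantly, on context types, where $L^{\vec p_1}(b_1)<:L^{\vec p_2}(b_2)$ iff $\vec p_1\ge\vec p_2$ componentwise and $b_1<:b_2$, covariantly for $+,\times$, with $\langle b_1,q_1\rangle<:\langle b_2,q_2\rangle$ iff $b_1<:b_2$ and $q_1\ge q_2$, and arrows contravariant in the argument and covariant in the result; relaxation: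 from $\Gamma;p_1\vdash e:\langle\tau,p_2\rangle$, $q_1\ge p_1$ and $q_1-q_2\ge p_1-p_2$ infer $\Gamma;q_1\vdash e:\langle\tau,q_2\rangle$. The cost bound read off from $\langle L^{\vec q}(\mathbf 1+\mathbf 1),c\rangle\to\langle b',c'\rangle$ is the polynomial $c+\sum_i q_i\binom{|w|}{i}$. *)

theory Defs
  imports "HOL-Computational_Algebra.Polynomial"
begin

section \<open>Turing machines\<close>

datatype dir = MoveL | MoveR

text \<open>The input alphabet \<open>{0,1}\<close> is a part of the tape alphabet through the embedding \<open>bit_sym\<close>
  (\<open>False\<close> is 0, \<open>True\<close> is 1).\<close>

record ('q, 'a) tm =
  states :: "'q set"
  tape_alphabet :: "'a set"
  bit_sym :: "bool \<Rightarrow> 'a"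
  left_end :: 'a
  blank :: 'a
  delta :: "'q \<Rightarrow> 'a \<Rightarrow> 'q \<times> 'a \<times> dir"
  start :: 'q
  final :: 'q

text \<open>The last conjunct says that the end marker is never overwritten and that the head never moves
  to the left of it.\<close>

definition turing_machine :: "('q, 'a) tm \<Rightarrow> bool" where
  "turing_machine M \<longleftrightarrow>
     finite (states M) \<and> finite (tape_alphabet M) \<and>
     inj (bit_sym M) \<and> range (bit_sym M) \<subseteq> tape_alphabet M \<and>
     left_end M \<in> tape_alphabet M - range (bit_sym M) \<and>
     blank M \<in> tape_alphabet M - range (bit_sym M) \<and>
     start M \<in> states M \<and> final M \<in> states M \<and>
     (\<forall>q\<in>states M. \<forall>a\<in>tape_alphabet M. delta M q a \<in> states M \<times> tape_alphabet M \<times> UNIV) \<and>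
     (\<forall>q\<in>states M - {final M}. \<exists>q'. delta M q (left_end M) = (q', left_end M, MoveR))"

text \<open>A configuration consists of the state, the tape and the head position; cell 0 is the left end.\<close>

type_synonym ('q, 'a) config = "'q \<times> (nat \<Rightarrow> 'a) \<times> nat"

definition tm_init :: "('q, 'a) tm \<Rightarrow> bool list \<Rightarrow> ('q, 'a) config" where
  "tm_init M w =
     (start M,
      (\<lambda>i. if i = 0 then left_end M
           else if i \<le> length w then bit_sym M (w ! (i - 1)) else blank M),
      1)"

definition tm_step :: "('q, 'a) tm \<Rightarrow> ('q, 'a) config \<Rightarrow> ('q, 'a) config" where
  "tm_step M = (\<lambda>(q, t, h). case delta M q (t h) of
     (q', a, d) \<Rightarrow> (q', t(h := a), case d of MoveL \<Rightarrow> h - 1 | MoveR \<Rightarrow> h + 1))"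

definition tm_config :: "('q, 'a) tm \<Rightarrow> bool list \<Rightarrow> nat \<Rightarrow> ('q, 'a) config" where
  "tm_config M w n = (tm_step M ^^ n) (tm_init M w)"

definition tm_halts :: "('q, 'a) tm \<Rightarrow> bool list \<Rightarrow> bool" where
  "tm_halts M w \<longleftrightarrow> (\<exists>n. fst (tm_config M w n) = final M)"

definition running_time :: "('q, 'a) tm \<Rightarrow> bool list \<Rightarrow> nat" where
  "running_time M w = (LEAST n. fst (tm_config M w n) = final M)"

definition tm_output :: "('q, 'a) tm \<Rightarrow> bool list \<Rightarrow> 'a list" where
  "tm_output M w =
     (let t = fst (snd (tm_config M w (running_time M w)))
      in map t [1..<(LEAST m. 1 \<le> m \<and> t m = blank M)])"

definition poly_time :: "('q, 'a) tm \<Rightarrow> bool" where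
  "poly_time M \<longleftrightarrow>
     (\<exists>p :: nat poly. \<forall>w. tm_halts M w \<and> running_time M w \<le> poly p (length w))"

definition outputs_bits :: "('q, 'a) tm \<Rightarrow> bool" where
  "outputs_bits M \<longleftrightarrow> (\<forall>w. set (tm_output M w) \<subseteq> range (bit_sym M))"

definition tm_fun :: "('q, 'a) tm \<Rightarrow> bool list \<Rightarrow> bool list" where
  "tm_fun M w = map (inv (bit_sym M)) (tm_output M w)"


section \<open>RaML: syntax and simple types\<close>

type_synonym var = string

datatype exp =
    EVar var
  | EUnit
  | EInL var
  | EInR var
  | ECaseSum var var exp exp          \<comment> \<open>\<open>ECaseSum x y el er\<close>: both branches bind \<open>y\<close>\<close>
  | EPair var var
  | ECasePair var var var exp
  | ENil
  | ECons var var
  | ECaseList var exp var var exp     \<comment> \<open>\<open>ECaseList x e0 x1 x2 e1\<close>\<close>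
  | EFun var var exp                  \<comment> \<open>\<open>EFun f x e\<close>: recursive, \<open>e\<close> may mention \<open>f\<close>\<close>
  | EApp var var
  | ETick rat
  | ELet var exp exp
  | EShare var var var exp            \<comment> \<open>\<open>EShare x x1 x2 e\<close>: share \<open>x\<close> as \<open>x1, x2\<close> in \<open>e\<close>\<close>

datatype sbase = SUnit | SSum sbase sbase | SProd sbase sbase | SList sbase

datatype sty = SBase sbase | SArrow sbase sbase

text \<open>Contexts are partial maps. An extension \<open>\<Gamma>, x : \<tau>\<close> presupposes \<open>x \<notin> dom \<Gamma>\<close>, which together with
  the disjoint union in the rule for \<open>ELet\<close> makes the system affine. A shadowed variable has to be
  dropped by weakening first.\<close>

inductive simple_typing :: "(var \<rightharpoonup> sty) \<Rightarrow> exp \<Rightarrow> sty \<Rightarrow> bool" where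
  st_Var: "simple_typing [x \<mapsto> \<tau>] (EVar x) \<tau>"
| st_Unit: "simple_typing Map.empty EUnit (SBase SUnit)"
| st_InL: "simple_typing [x \<mapsto> SBase b1] (EInL x) (SBase (SSum b1 b2))"
| st_InR: "simple_typing [x \<mapsto> SBase b2] (EInR x) (SBase (SSum b1 b2))"
| st_CaseSum: "\<lbrakk>x \<notin> dom \<Gamma>; y \<notin> dom \<Gamma>;
     simple_typing (\<Gamma>(y \<mapsto> SBase b1)) el \<tau>; simple_typing (\<Gamma>(y \<mapsto> SBase b2)) er \<tau>\<rbrakk>
   \<Longrightarrow> simple_typing (\<Gamma>(x \<mapsto> SBase (SSum b1 b2))) (ECaseSum x y el er) \<tau>"
| st_Pair: "x1 \<noteq> x2
   \<Longrightarrow> simple_typing [x1 \<mapsto> SBase b1, x2 \<mapsto> SBase b2] (EPair x1 x2) (SBase (SProd b1 b2))"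
| st_CasePair: "\<lbrakk>x \<notin> dom \<Gamma>; x1 \<notin> dom \<Gamma>; x2 \<notin> dom \<Gamma>; x1 \<noteq> x2;
     simple_typing (\<Gamma>(x1 \<mapsto> SBase b1, x2 \<mapsto> SBase b2)) e \<tau>\<rbrakk>
   \<Longrightarrow> simple_typing (\<Gamma>(x \<mapsto> SBase (SProd b1 b2))) (ECasePair x x1 x2 e) \<tau>"
| st_Nil: "simple_typing Map.empty ENil (SBase (SList b))"
| st_Cons: "x1 \<noteq> x2
   \<Longrightarrow> simple_typing [x1 \<mapsto> SBase b, x2 \<mapsto> SBase (SList b)] (ECons x1 x2) (SBase (SList b))"
| st_CaseList: "\<lbrakk>x \<notin> dom \<Gamma>; x1 \<notin> dom \<Gamma>; x2 \<notin> dom \<Gamma>; x1 \<noteq> x2;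
     simple_typing \<Gamma> e0 \<tau>;
     simple_typing (\<Gamma>(x1 \<mapsto> SBase b, x2 \<mapsto> SBase (SList b))) e1 \<tau>\<rbrakk>
   \<Longrightarrow> simple_typing (\<Gamma>(x \<mapsto> SBase (SList b))) (ECaseList x e0 x1 x2 e1) \<tau>"
| st_Fun: "\<lbrakk>f \<notin> dom \<Gamma>; x \<notin> dom \<Gamma>; f \<noteq> x;
     simple_typing (\<Gamma>(f \<mapsto> SArrow b1 b2, x \<mapsto> SBase b1)) e (SBase b2)\<rbrakk>
   \<Longrightarrow> simple_typing \<Gamma> (EFun f x e) (SArrow b1 b2)"
| st_App: "f \<noteq> x
   \<Longrightarrow> simple_typing [f \<mapsto> SArrow b1 b2, x \<mapsto> SBase b1] (EApp f x) (SBase b2)"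
| st_Tick: "simple_typing Map.empty (ETick q) (SBase SUnit)"
| st_Let: "\<lbrakk>dom \<Gamma>1 \<inter> dom \<Gamma>2 = {}; x \<notin> dom \<Gamma>2;
     simple_typing \<Gamma>1 e1 \<tau>1; simple_typing (\<Gamma>2(x \<mapsto> \<tau>1)) e2 \<tau>2\<rbrakk>
   \<Longrightarrow> simple_typing (\<Gamma>1 ++ \<Gamma>2) (ELet x e1 e2) \<tau>2"
| st_Share: "\<lbrakk>x \<notin> dom \<Gamma>; x1 \<notin> dom \<Gamma>; x2 \<notin> dom \<Gamma>; x1 \<noteq> x2;
     simple_typing (\<Gamma>(x1 \<mapsto> \<tau>, x2 \<mapsto> \<tau>)) e \<tau>'\<rbrakk>
   \<Longrightarrow> simple_typing (\<Gamma>(x \<mapsto> \<tau>)) (EShare x x1 x2 e) \<tau>'"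
| st_Weaken: "\<lbrakk>simple_typing \<Gamma> e \<tau>; \<Gamma> \<subseteq>\<^sub>m \<Gamma>'\<rbrakk> \<Longrightarrow> simple_typing \<Gamma>' e \<tau>"


section \<open>RaML: evaluation with the tick metric\<close>

datatype val =
    VUnit
  | VInL val
  | VInR val
  | VPair val val
  | VNil
  | VCons val val
  | VClosure "var \<rightharpoonup> val" var var exp

inductive eval :: "(var \<rightharpoonup> val) \<Rightarrow> exp \<Rightarrow> val \<Rightarrow> rat \<Rightarrow> bool" where
  ev_Var: "E x = Some v \<Longrightarrow> eval E (EVar x) v 0"
| ev_Unit: "eval E EUnit VUnit 0"
| ev_InL: "E x = Some v \<Longrightarrow> eval E (EInL x) (VInL v) 0"
| ev_InR: "E x = Some v \<Longrightarrow> eval E (EInR x) (VInR v) 0"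
| ev_CaseSumL: "\<lbrakk>E x = Some (VInL v); eval (E(y \<mapsto> v)) el r k\<rbrakk>
   \<Longrightarrow> eval E (ECaseSum x y el er) r k"
| ev_CaseSumR: "\<lbrakk>E x = Some (VInR v); eval (E(y \<mapsto> v)) er r k\<rbrakk>
   \<Longrightarrow> eval E (ECaseSum x y el er) r k"
| ev_Pair: "\<lbrakk>E x1 = Some v1; E x2 = Some v2\<rbrakk> \<Longrightarrow> eval E (EPair x1 x2) (VPair v1 v2) 0"
| ev_CasePair: "\<lbrakk>E x = Some (VPair v1 v2); eval (E(x1 \<mapsto> v1, x2 \<mapsto> v2)) e r k\<rbrakk>
   \<Longrightarrow> eval E (ECasePair x x1 x2 e) r k"
| ev_Nil: "eval E ENil VNil 0"
| ev_Cons: "\<lbrakk>E x1 = Some v1; E x2 = Some v2\<rbrakk> \<Longrightarrow> eval E (ECons x1 x2) (VCons v1 v2) 0"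
| ev_CaseNil: "\<lbrakk>E x = Some VNil; eval E e0 r k\<rbrakk> \<Longrightarrow> eval E (ECaseList x e0 x1 x2 e1) r k"
| ev_CaseCons: "\<lbrakk>E x = Some (VCons v1 v2); eval (E(x1 \<mapsto> v1, x2 \<mapsto> v2)) e1 r k\<rbrakk>
   \<Longrightarrow> eval E (ECaseList x e0 x1 x2 e1) r k"
| ev_Fun: "eval E (EFun f x e) (VClosure E f x e) 0"
| ev_App: "\<lbrakk>E f = Some (VClosure E' g y e); E x = Some v;
     eval (E'(g \<mapsto> VClosure E' g y e, y \<mapsto> v)) e r k\<rbrakk>
   \<Longrightarrow> eval E (EApp f x) r k"
| ev_Tick: "eval E (ETick q) VUnit q"
| ev_Let: "\<lbrakk>eval E e1 v k1; eval (E(x \<mapsto> v)) e2 r k2\<rbrakk> \<Longrightarrow> eval E (ELet x e1 e2) r (k1 + k2)"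
| ev_Share: "\<lbrakk>E x = Some v; eval (E(x1 \<mapsto> v, x2 \<mapsto> v)) e r k\<rbrakk>
   \<Longrightarrow> eval E (EShare x x1 x2 e) r k"

text \<open>A closed expression of arrow type is run on an argument value by evaluating it to a closure and
  entering the closure; the cost of both phases counts.\<close>

definition eval_on :: "exp \<Rightarrow> val \<Rightarrow> val \<Rightarrow> rat \<Rightarrow> bool" where
  "eval_on P v r k \<longleftrightarrow>
     (\<exists>E f x e k1 k2. eval Map.empty P (VClosure E f x e) k1 \<and>
        eval (E(f \<mapsto> VClosure E f x e, x \<mapsto> v)) e r k2 \<and> k = k1 + k2)"

abbreviation s_bits :: sbase where
  "s_bits \<equiv> SList (SSum SUnit SUnit)"

definition enc_bit :: "bool \<Rightarrow> val" where
  "enc_bit b = (if b then VInR VUnit else VInL VUnit)"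

primrec enc_bits :: "bool list \<Rightarrow> val" where
  "enc_bits [] = VNil"
| "enc_bits (b # w) = VCons (enc_bit b) (enc_bits w)"


section \<open>Univariate AARA\<close>

text \<open>A list annotation \<open>(q\<^sub>1, \<dots>, q\<^sub>k)\<close> is the list \<open>[q\<^sub>1, \<dots>, q\<^sub>k]\<close>. Annotations are compared and added
  through \<open>nth_default 0\<close>, that is, up to padding by zeros.\<close>

datatype abase = AUnit | ASum abase abase | AProd abase abase | AList "rat list" abase

type_synonym ann = "abase \<times> rat"

datatype arrow = Arrow ann ann

datatype aty = Base abase | Funs "arrow set"

primrec erase :: "abase \<Rightarrow> sbase" where
  "erase AUnit = SUnit"
| "erase (ASum b1 b2) = SSum (erase b1) (erase b2)"
| "erase (AProd b1 b2) = SProd (erase b1) (erase b2)"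
| "erase (AList q b) = SList (erase b)"

fun erase_arrow :: "arrow \<Rightarrow> sty" where
  "erase_arrow (Arrow (b1, q1) (b2, q2)) = SArrow (erase b1) (erase b2)"

primrec nonneg :: "abase \<Rightarrow> bool" where
  "nonneg AUnit \<longleftrightarrow> True"
| "nonneg (ASum b1 b2) \<longleftrightarrow> nonneg b1 \<and> nonneg b2"
| "nonneg (AProd b1 b2) \<longleftrightarrow> nonneg b1 \<and> nonneg b2"
| "nonneg (AList q b) \<longleftrightarrow> (\<forall>r\<in>set q. 0 \<le> r) \<and> nonneg b"

fun nonneg_arrow :: "arrow \<Rightarrow> bool" where
  "nonneg_arrow (Arrow (b1, q1) (b2, q2)) \<longleftrightarrow> nonneg b1 \<and> 0 \<le> q1 \<and> nonneg b2 \<and> 0 \<le> q2"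

definition wf_arrows :: "arrow set \<Rightarrow> bool" where
  "wf_arrows T \<longleftrightarrow> T \<noteq> {} \<and> (\<forall>A\<in>T. nonneg_arrow A) \<and> (\<exists>s. \<forall>A\<in>T. erase_arrow A = s)"

primrec wf_aty :: "aty \<Rightarrow> bool" where
  "wf_aty (Base b) \<longleftrightarrow> nonneg b"
| "wf_aty (Funs T) \<longleftrightarrow> wf_arrows T"

definition wf_ctx :: "(var \<rightharpoonup> aty) \<Rightarrow> bool" where
  "wf_ctx \<Gamma> \<longleftrightarrow> (\<forall>x \<tau>. \<Gamma> x = Some \<tau> \<longrightarrow> wf_aty \<tau>)"

definition shift :: "rat list \<Rightarrow> rat list" where
  "shift q = map2 (+) q (tl q @ [0])"

primrec zero_ann :: "abase \<Rightarrow> bool" where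
  "zero_ann AUnit \<longleftrightarrow> True"
| "zero_ann (ASum b1 b2) \<longleftrightarrow> zero_ann b1 \<and> zero_ann b2"
| "zero_ann (AProd b1 b2) \<longleftrightarrow> zero_ann b1 \<and> zero_ann b2"
| "zero_ann (AList q b) \<longleftrightarrow> (\<forall>r\<in>set q. r = 0) \<and> zero_ann b"

definition zero_ctx :: "(var \<rightharpoonup> aty) \<Rightarrow> bool" where
  "zero_ctx \<Gamma> \<longleftrightarrow> (\<forall>x b. \<Gamma> x = Some (Base b) \<longrightarrow> zero_ann b)"

text \<open>\<open>splits b b1 b2\<close>: \<open>b\<close> splits into \<open>(b1, b2)\<close>.\<close>

inductive splits :: "abase \<Rightarrow> abase \<Rightarrow> abase \<Rightarrow> bool" where
  "splits AUnit AUnit AUnit"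
| "\<lbrakk>splits b b1 b2; splits c c1 c2\<rbrakk> \<Longrightarrow> splits (ASum b c) (ASum b1 c1) (ASum b2 c2)"
| "\<lbrakk>splits b b1 b2; splits c c1 c2\<rbrakk> \<Longrightarrow> splits (AProd b c) (AProd b1 c1) (AProd b2 c2)"
| "\<lbrakk>\<forall>i. nth_default 0 p i = nth_default 0 p1 i + nth_default 0 p2 i; splits b b1 b2\<rbrakk>
   \<Longrightarrow> splits (AList p b) (AList p1 b1) (AList p2 b2)"

inductive splits_aty :: "aty \<Rightarrow> aty \<Rightarrow> aty \<Rightarrow> bool" where
  "splits b b1 b2 \<Longrightarrow> splits_aty (Base b) (Base b1) (Base b2)"
| "\<lbrakk>T1 \<subseteq> T; T2 \<subseteq> T\<rbrakk> \<Longrightarrow> splits_aty (Funs T) (Funs T1) (Funs T2)"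

inductive subtype :: "abase \<Rightarrow> abase \<Rightarrow> bool" where
  "subtype AUnit AUnit"
| "\<lbrakk>subtype b b'; subtype c c'\<rbrakk> \<Longrightarrow> subtype (ASum b c) (ASum b' c')"
| "\<lbrakk>subtype b b'; subtype c c'\<rbrakk> \<Longrightarrow> subtype (AProd b c) (AProd b' c')"
| "\<lbrakk>\<forall>i. nth_default 0 p2 i \<le> nth_default 0 p1 i; subtype b1 b2\<rbrakk>
   \<Longrightarrow> subtype (AList p1 b1) (AList p2 b2)"

fun subtype_ann :: "ann \<Rightarrow> ann \<Rightarrow> bool" where
  "subtype_ann (b1, q1) (b2, q2) \<longleftrightarrow> subtype b1 b2 \<and> q2 \<le> q1"

fun subtype_arrow :: "arrow \<Rightarrow> arrow \<Rightarrow> bool" where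
  "subtype_arrow (Arrow B1 B2) (Arrow C1 C2) \<longleftrightarrow> subtype_ann C1 B1 \<and> subtype_ann B2 C2"

inductive subtype_aty :: "aty \<Rightarrow> aty \<Rightarrow> bool" where
  "subtype b1 b2 \<Longrightarrow> subtype_aty (Base b1) (Base b2)"
| "(\<forall>A'\<in>T'. \<exists>A\<in>T. subtype_arrow A A') \<Longrightarrow> subtype_aty (Funs T) (Funs T')"

text \<open>The degree is the largest index of a non-zero entry in a list annotation.\<close>

primrec degree_ann :: "abase \<Rightarrow> nat" where
  "degree_ann AUnit = 0"
| "degree_ann (ASum b1 b2) = max (degree_ann b1) (degree_ann b2)"
| "degree_ann (AProd b1 b2) = max (degree_ann b1) (degree_ann b2)"
| "degree_ann (AList q b) = max (length (strip_while (\<lambda>r. r = 0) q)) (degree_ann b)"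

fun degree_arrow :: "arrow \<Rightarrow> nat" where
  "degree_arrow (Arrow (b1, q1) (b2, q2)) = max (degree_ann b1) (degree_ann b2)"

text \<open>\<open>diff_arrow C B D\<close>: \<open>D\<close> is the annotation-wise difference \<open>C - B\<close>, in the form \<open>C = B + D\<close>; the
  relation \<open>splits\<close> is the annotation-wise sum on base types.\<close>

fun diff_arrow :: "arrow \<Rightarrow> arrow \<Rightarrow> arrow \<Rightarrow> bool" where
  "diff_arrow (Arrow (c1, r1) (c2, r2)) (Arrow (b1, q1) (b2, q2)) (Arrow (d1, s1) (d2, s2)) \<longleftrightarrow>
     splits c1 b1 d1 \<and> r1 = q1 + s1 \<and> splits c2 b2 d2 \<and> r2 = q2 + s2"

datatype metric = Ticks | CostFree

fun tick_cost :: "metric \<Rightarrow> rat \<Rightarrow> rat" where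
  "tick_cost Ticks q = q"
| "tick_cost CostFree q = 0"

text \<open>\<open>aara m \<Gamma> q e \<tau> p\<close> is the judgment \<open>\<Gamma>; q \<turnstile> e : \<langle>\<tau>, p\<rangle>\<close> for the metric \<open>m\<close>. In the rule for \<open>EFun\<close>,
  the set \<open>insert A R\<close> contains the types at which \<open>f\<close> may be called recursively in the derivation of
  the type \<open>A\<close>: besides \<open>A\<close> itself these are, for the metric \<open>Ticks\<close> only, types \<open>C \<in> T\<close> whose
  difference \<open>D\<close> from \<open>A\<close> has lower degree and is derivable for \<open>f\<close> without costs, where recursive calls
  have type \<open>D\<close>. The types of the functions in \<open>\<Gamma>\<close> are kept in the derivation without costs.\<close>

inductive aara :: "metric \<Rightarrow> (var \<rightharpoonup> aty) \<Rightarrow> rat \<Rightarrow> exp \<Rightarrow> aty \<Rightarrow> rat \<Rightarrow> bool" where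
  aara_Var: "wf_aty \<tau> \<Longrightarrow> aara m [x \<mapsto> \<tau>] 0 (EVar x) \<tau> 0"
| aara_Unit: "aara m Map.empty 0 EUnit (Base AUnit) 0"
| aara_Tick: "0 \<le> tick_cost m q \<Longrightarrow> aara m Map.empty (tick_cost m q) (ETick q) (Base AUnit) 0"
| aara_InL: "\<lbrakk>nonneg b1; nonneg b2\<rbrakk> \<Longrightarrow> aara m [x \<mapsto> Base b1] 0 (EInL x) (Base (ASum b1 b2)) 0"
| aara_InR: "\<lbrakk>nonneg b1; nonneg b2\<rbrakk> \<Longrightarrow> aara m [x \<mapsto> Base b2] 0 (EInR x) (Base (ASum b1 b2)) 0"
| aara_Pair: "\<lbrakk>x1 \<noteq> x2; nonneg b1; nonneg b2\<rbrakk>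
   \<Longrightarrow> aara m [x1 \<mapsto> Base b1, x2 \<mapsto> Base b2] 0 (EPair x1 x2) (Base (AProd b1 b2)) 0"
| aara_Nil: "nonneg (AList q b) \<Longrightarrow> aara m Map.empty 0 ENil (Base (AList q b)) 0"
| aara_Cons: "\<lbrakk>x1 \<noteq> x2; nonneg (AList q b)\<rbrakk>
   \<Longrightarrow> aara m [x1 \<mapsto> Base b, x2 \<mapsto> Base (AList (shift q) b)] (nth_default 0 q 0)
         (ECons x1 x2) (Base (AList q b)) 0"
| aara_CaseSum: "\<lbrakk>x \<notin> dom \<Gamma>; y \<notin> dom \<Gamma>;
     aara m (\<Gamma>(y \<mapsto> Base b1)) q el (Base b) p; aara m (\<Gamma>(y \<mapsto> Base b2)) q er (Base b) p\<rbrakk>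
   \<Longrightarrow> aara m (\<Gamma>(x \<mapsto> Base (ASum b1 b2))) q (ECaseSum x y el er) (Base b) p"
| aara_CasePair: "\<lbrakk>x \<notin> dom \<Gamma>; x1 \<notin> dom \<Gamma>; x2 \<notin> dom \<Gamma>; x1 \<noteq> x2;
     aara m (\<Gamma>(x1 \<mapsto> Base b1, x2 \<mapsto> Base b2)) q e (Base b) p\<rbrakk>
   \<Longrightarrow> aara m (\<Gamma>(x \<mapsto> Base (AProd b1 b2))) q (ECasePair x x1 x2 e) (Base b) p"
| aara_CaseList: "\<lbrakk>x \<notin> dom \<Gamma>; x1 \<notin> dom \<Gamma>; x2 \<notin> dom \<Gamma>; x1 \<noteq> x2; nonneg (AList r b);
     aara m \<Gamma> q e0 (Base b') p;
     aara m (\<Gamma>(x1 \<mapsto> Base b, x2 \<mapsto> Base (AList (shift r) b))) (q + nth_default 0 r 0) e1 (Base b') p\<rbrakk>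
   \<Longrightarrow> aara m (\<Gamma>(x \<mapsto> Base (AList r b))) q (ECaseList x e0 x1 x2 e1) (Base b') p"
| aara_Let: "\<lbrakk>dom \<Gamma>1 \<inter> dom \<Gamma>2 = {}; x \<notin> dom \<Gamma>2;
     aara m \<Gamma>1 q e1 \<tau> r; aara m (\<Gamma>2(x \<mapsto> \<tau>)) r e2 (Base b) p\<rbrakk>
   \<Longrightarrow> aara m (\<Gamma>1 ++ \<Gamma>2) q (ELet x e1 e2) (Base b) p"
| aara_Share: "\<lbrakk>x \<notin> dom \<Gamma>; x1 \<notin> dom \<Gamma>; x2 \<notin> dom \<Gamma>; x1 \<noteq> x2;
     wf_aty \<tau>; splits_aty \<tau> \<tau>1 \<tau>2;
     aara m (\<Gamma>(x1 \<mapsto> \<tau>1, x2 \<mapsto> \<tau>2)) q e (Base b) p\<rbrakk>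
   \<Longrightarrow> aara m (\<Gamma>(x \<mapsto> \<tau>)) q (EShare x x1 x2 e) (Base b) p"
| aara_Fun: "\<lbrakk>f \<notin> dom \<Gamma>; x \<notin> dom \<Gamma>; f \<noteq> x; zero_ctx \<Gamma>; wf_arrows T;
     \<forall>A\<in>T. \<exists>b1 q1 b2 q2 R. A = Arrow (b1, q1) (b2, q2) \<and> R \<subseteq> T \<and>
       (\<forall>C\<in>R. m = Ticks \<and>
          (\<exists>D d1 s1 d2 s2. D = Arrow (d1, s1) (d2, s2) \<and> diff_arrow C A D \<and> nonneg_arrow D \<and>
             degree_arrow D < degree_arrow A \<and> degree_arrow D < degree_arrow C \<and>
             aara CostFree (\<Gamma>(f \<mapsto> Funs {D}, x \<mapsto> Base d1)) s1 e (Base d2) s2)) \<and>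
       aara m (\<Gamma>(f \<mapsto> Funs (insert A R), x \<mapsto> Base b1)) q1 e (Base b2) q2\<rbrakk>
   \<Longrightarrow> aara m \<Gamma> 0 (EFun f x e) (Funs T) 0"
| aara_App: "\<lbrakk>f \<noteq> x; wf_arrows T; Arrow (b1, q) (b2, p) \<in> T\<rbrakk>
   \<Longrightarrow> aara m [f \<mapsto> Funs T, x \<mapsto> Base b1] q (EApp f x) (Base b2) p"
| aara_Weaken: "\<lbrakk>aara m \<Gamma> q e \<tau> p; \<Gamma> \<subseteq>\<^sub>m \<Gamma>'; wf_ctx \<Gamma>'\<rbrakk> \<Longrightarrow> aara m \<Gamma>' q e \<tau> p"
| aara_SubResult: "\<lbrakk>aara m \<Gamma> q e \<tau> p; subtype_aty \<tau> \<tau>'; p' \<le> p; wf_aty \<tau>'; 0 \<le> p'\<rbrakk>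
   \<Longrightarrow> aara m \<Gamma> q e \<tau>' p'"
| aara_SubContext: "\<lbrakk>x \<notin> dom \<Gamma>; aara m (\<Gamma>(x \<mapsto> \<tau>)) q e \<tau>' p; subtype_aty \<tau>0 \<tau>; wf_aty \<tau>0\<rbrakk>
   \<Longrightarrow> aara m (\<Gamma>(x \<mapsto> \<tau>0)) q e \<tau>' p"
| aara_Relax: "\<lbrakk>aara m \<Gamma> p1 e \<tau> p2; p1 \<le> q1; p1 - p2 \<le> q1 - q2; 0 \<le> q2\<rbrakk>
   \<Longrightarrow> aara m \<Gamma> q1 e \<tau> q2"

definition has_arrow_type :: "exp \<Rightarrow> arrow \<Rightarrow> bool" where
  "has_arrow_type P A \<longleftrightarrow> (\<exists>T. A \<in> T \<and> aara Ticks Map.empty 0 P (Funs T) 0)"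

text \<open>The side conditions on signs in the rules suffice for all annotations in a derivable judgment to
  be non-negative.\<close>

lemma wf_ctx_upd: "wf_ctx (\<Gamma>(x \<mapsto> \<tau>)) \<Longrightarrow> x \<notin> dom \<Gamma> \<Longrightarrow> wf_ctx \<Gamma> \<and> wf_aty \<tau>"
  unfolding wf_ctx_def by (metis domI fun_upd_apply)

lemma wf_ctx_updI: "wf_ctx \<Gamma> \<Longrightarrow> wf_aty \<tau> \<Longrightarrow> wf_ctx (\<Gamma>(x \<mapsto> \<tau>))"
  unfolding wf_ctx_def by simp

lemma wf_ctx_add: "wf_ctx \<Gamma>1 \<Longrightarrow> wf_ctx \<Gamma>2 \<Longrightarrow> wf_ctx (\<Gamma>1 ++ \<Gamma>2)"
  unfolding wf_ctx_def by (auto simp: map_add_Some_iff)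

lemma nonneg_shift:
  assumes "\<forall>r\<in>set q. 0 \<le> r"
  shows "\<forall>r\<in>set (shift q). 0 \<le> r"
proof
  fix r assume "r \<in> set (shift q)"
  then obtain u v where uv: "(u, v) \<in> set (zip q (tl q @ [0]))" and r: "r = u + v"
    by (auto simp: shift_def)
  from uv have "u \<in> set q" by (rule set_zip_leftD)
  moreover from uv have "v \<in> set (tl q @ [0])" by (rule set_zip_rightD)
  then have "v \<in> set q \<or> v = 0" by (cases q) auto
  ultimately show "0 \<le> r" using assms r by fastforce
qed

lemma aara_wf:
  "aara m \<Gamma> q e \<tau> p \<Longrightarrow> wf_ctx \<Gamma> \<and> 0 \<le> q \<and> wf_aty \<tau> \<and> 0 \<le> p"
proof (induction rule: aara.induct)
  case (aara_Cons x1 x2 q b m)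
  then show ?case
    using nonneg_shift[of q]
    by (auto simp: wf_ctx_def nth_default_def)
next
  case (aara_CaseSum x \<Gamma> y m b1 q el b p b2 er)
  then have "wf_ctx \<Gamma>" "wf_aty (Base b1)" "wf_aty (Base b2)"
    by (blast dest: wf_ctx_upd)+
  moreover from this have "wf_ctx (\<Gamma>(x \<mapsto> Base (ASum b1 b2)))"
    by (intro wf_ctx_updI) auto
  ultimately show ?case using aara_CaseSum by blast
next
  case (aara_CasePair x \<Gamma> x1 x2 m b1 b2 q e b p)
  then have "wf_ctx (\<Gamma>(x1 \<mapsto> Base b1))" "wf_aty (Base b2)"
    using wf_ctx_upd[of "\<Gamma>(x1 \<mapsto> Base b1)" x2 "Base b2"] by force+
  then have "wf_ctx \<Gamma>" "wf_aty (Base b1)" "wf_aty (Base b2)"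
    using aara_CasePair.hyps wf_ctx_upd by blast+
  moreover from this have "wf_ctx (\<Gamma>(x \<mapsto> Base (AProd b1 b2)))"
    by (intro wf_ctx_updI) auto
  ultimately show ?case using aara_CasePair by blast
next
  case (aara_CaseList x \<Gamma> x1 x2 r b m q e0 b' p e1)
  then have "wf_ctx (\<Gamma>(x \<mapsto> Base (AList r b)))"
    by (intro wf_ctx_updI) auto
  with aara_CaseList show ?case by blast
next
  case (aara_Let \<Gamma>1 \<Gamma>2 x m q e1 \<tau> r e2 b p)
  then have "wf_ctx \<Gamma>2" using wf_ctx_upd by blast
  with aara_Let show ?case by (auto intro!: wf_ctx_add)
next
  case (aara_Share x \<Gamma> x1 x2 \<tau> \<tau>1 \<tau>2 m q e b p)
  then have "wf_ctx (\<Gamma>(x1 \<mapsto> \<tau>1))"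
    using wf_ctx_upd[of "\<Gamma>(x1 \<mapsto> \<tau>1)" x2 \<tau>2] by force
  then have "wf_ctx \<Gamma>"
    using aara_Share.hyps wf_ctx_upd by blast
  moreover from this have "wf_ctx (\<Gamma>(x \<mapsto> \<tau>))"
    using aara_Share.hyps by (intro wf_ctx_updI) auto
  ultimately show ?case using aara_Share by blast
next
  case (aara_Fun f \<Gamma> x T e m)
  then obtain A where "A \<in> T" by (auto simp: wf_arrows_def)
  with aara_Fun obtain \<tau> b where "wf_ctx (\<Gamma>(f \<mapsto> \<tau>, x \<mapsto> Base b))" by blast
  then have "wf_ctx (\<Gamma>(f \<mapsto> \<tau>))"
    using aara_Fun.hyps wf_ctx_upd[of "\<Gamma>(f \<mapsto> \<tau>)" x "Base b"] by force
  then have "wf_ctx \<Gamma>"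
    using aara_Fun.hyps wf_ctx_upd by blast
  with aara_Fun show ?case by simp
next
  case (aara_App f x T b1 q b2 p m)
  then have "nonneg_arrow (Arrow (b1, q) (b2, p))" by (auto simp: wf_arrows_def)
  with aara_App show ?case by (auto simp: wf_ctx_def)
next
  case (aara_SubContext x \<Gamma> m \<tau> q e \<tau>' p \<tau>0)
  then have "wf_ctx \<Gamma>" using wf_ctx_upd[of \<Gamma> x \<tau>] by blast
  moreover from this have "wf_ctx (\<Gamma>(x \<mapsto> \<tau>0))"
    using aara_SubContext.hyps by (intro wf_ctx_updI) auto
  ultimately show ?case using aara_SubContext by blast
qed (auto simp: wf_ctx_def)

end

theory Submission
  imports Defs
begin

text \<open>The program simulates \<open>M\<close> on a zipper representation of the tape. The number of simulated steps
  is fixed in advance: with \<open>F 0 n = 1\<close>, \<open>F (k + 1) 0 = 1\<close> and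
  \<open>F (k + 1) (n + 1) = F k n + F (k + 1) n\<close>, every polynomial is bounded by \<open>N * F k n\<close> for some
  \<open>N\<close> and \<open>k\<close>, and this is the number of ticks of a \<open>k\<close>-fold nested loop over the tails of the
  input which ticks \<open>N\<close> and simulates \<open>N\<close> steps at nesting depth \<open>k\<close> and at the end of each list.
  The recursion equation of \<open>F\<close> is matched by the annotations: the shift of \<open>(N, \<dots>, N)\<close> of length
  \<open>k + 1\<close> is the sum of the vectors \<open>(N, \<dots>, N)\<close> of lengths \<open>k\<close> and \<open>k + 1\<close>. So each loop is
  typable with recursive calls at its own type only, and everything apart from the loop counters
  carries zero annotations.\<close>

section \<open>Evaluation and erasure\<close>

inductive_cases eval_VarE: "eval E (EVar x) v k"
inductive_cases eval_UnitE: "eval E EUnit v k"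
inductive_cases eval_InLE: "eval E (EInL x) v k"
inductive_cases eval_InRE: "eval E (EInR x) v k"
inductive_cases eval_CaseSumE: "eval E (ECaseSum x y el er) v k"
inductive_cases eval_PairE: "eval E (EPair x1 x2) v k"
inductive_cases eval_CasePairE: "eval E (ECasePair x x1 x2 e) v k"
inductive_cases eval_NilE: "eval E ENil v k"
inductive_cases eval_ConsE: "eval E (ECons x1 x2) v k"
inductive_cases eval_CaseListE: "eval E (ECaseList x e0 x1 x2 e1) v k"
inductive_cases eval_FunE: "eval E (EFun f x e) v k"
inductive_cases eval_AppE: "eval E (EApp f x) v k"
inductive_cases eval_TickE: "eval E (ETick q) v k"
inductive_cases eval_LetE: "eval E (ELet x e1 e2) v k"
inductive_cases eval_ShareE: "eval E (EShare x x1 x2 e) v k"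

text \<open>The cost requirement speaks of every evaluation, while the correctness lemmas below
  construct one. Determinism makes the cost of the constructed one the only possible cost.\<close>

lemma eval_deterministic:
  "eval E e v k \<Longrightarrow> eval E e v' k' \<Longrightarrow> v' = v \<and> k' = k"
proof (induction arbitrary: v' k' rule: eval.induct)
  case ev_Var then show ?case by (auto elim!: eval_VarE)
next
  case ev_Unit then show ?case by (auto elim!: eval_UnitE)
next
  case ev_InL then show ?case by (auto elim!: eval_InLE)
next
  case ev_InR then show ?case by (auto elim!: eval_InRE)
next
  case ev_CaseSumL
  from ev_CaseSumL.prems show ?case
    by (rule eval_CaseSumE) (use ev_CaseSumL.hyps in \<open>auto dest!: ev_CaseSumL.IH simp del: fun_upd_apply\<close>)
next
  case ev_CaseSumR
  from ev_CaseSumR.prems show ?case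
    by (rule eval_CaseSumE) (use ev_CaseSumR.hyps in \<open>auto dest!: ev_CaseSumR.IH simp del: fun_upd_apply\<close>)
next
  case ev_Pair then show ?case by (auto elim!: eval_PairE)
next
  case ev_CasePair
  from ev_CasePair.prems show ?case
    by (rule eval_CasePairE) (use ev_CasePair.hyps in \<open>auto dest!: ev_CasePair.IH simp del: fun_upd_apply\<close>)
next
  case ev_Nil then show ?case by (auto elim!: eval_NilE)
next
  case ev_Cons then show ?case by (auto elim!: eval_ConsE)
next
  case ev_CaseNil
  from ev_CaseNil.prems show ?case
    by (rule eval_CaseListE) (use ev_CaseNil.hyps in \<open>auto dest!: ev_CaseNil.IH simp del: fun_upd_apply\<close>)
next
  case ev_CaseCons
  from ev_CaseCons.prems show ?case
    by (rule eval_CaseListE) (use ev_CaseCons.hyps in \<open>auto dest!: ev_CaseCons.IH simp del: fun_upd_apply\<close>)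
next
  case ev_Fun then show ?case by (auto elim!: eval_FunE)
next
  case ev_App
  from ev_App.prems show ?case
    by (rule eval_AppE) (use ev_App.hyps in \<open>auto dest!: ev_App.IH simp del: fun_upd_apply\<close>)
next
  case ev_Tick then show ?case by (auto elim!: eval_TickE)
next
  case ev_Let
  from ev_Let.prems show ?case
    by (rule eval_LetE) (use ev_Let in blast)
next
  case ev_Share
  from ev_Share.prems show ?case
    by (rule eval_ShareE) (use ev_Share.hyps in \<open>auto dest!: ev_Share.IH simp del: fun_upd_apply\<close>)
qed

lemma eval_let0:
  "eval E e1 v 0 \<Longrightarrow> eval (E(x \<mapsto> v)) e2 r k \<Longrightarrow> eval E (ELet x e1 e2) r k"
  using ev_Let[of E e1 v 0 x e2 r k] by simp

section \<open>Erasing annotated typings to simple typings\<close>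

primrec erase_aty :: "aty \<Rightarrow> sty" where
  "erase_aty (Base b) = SBase (erase b)"
| "erase_aty (Funs T) = erase_arrow (SOME A. A \<in> T)"

text \<open>All arrows of a well-formed set erase alike, so the arbitrary choice in
  \<open>erase_aty\<close> does not matter.\<close>

lemma erase_Funs: "wf_arrows T \<Longrightarrow> A \<in> T \<Longrightarrow> erase_aty (Funs T) = erase_arrow A"
  unfolding wf_arrows_def by (metis erase_aty.simps(2) someI)

lemma wf_arrows_subset: "wf_arrows T \<Longrightarrow> S \<subseteq> T \<Longrightarrow> S \<noteq> {} \<Longrightarrow> wf_arrows S"
  unfolding wf_arrows_def by (meson subsetD)

lemma erase_subtype: "subtype b c \<Longrightarrow> erase b = erase c"
  by (induction rule: subtype.induct) auto

lemma erase_splits: "splits b c d \<Longrightarrow> erase c = erase b \<and> erase d = erase b"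
  by (induction rule: splits.induct) auto

lemma erase_subtype_arrow: "subtype_arrow A B \<Longrightarrow> erase_arrow A = erase_arrow B"
  by (cases "(A, B)" rule: subtype_arrow.cases)
    (auto simp: erase_subtype elim!: subtype_ann.elims)

lemma erase_subtype_aty:
  assumes "subtype_aty \<tau> \<tau>'" "wf_aty \<tau>" "wf_aty \<tau>'"
  shows "erase_aty \<tau> = erase_aty \<tau>'"
  using assms
proof cases
  case (2 T' T)
  then obtain A' where "A' \<in> T'" using assms by (auto simp: wf_arrows_def)
  with 2 obtain A where "A \<in> T" "subtype_arrow A A'" by blast
  with 2 \<open>A' \<in> T'\<close> assms show ?thesis
    by (metis erase_Funs erase_subtype_arrow wf_aty.simps(2))
qed (auto dest: erase_subtype)

text \<open>Well-formed parts of a function set are non-empty and hence share an element with the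
  whole, which fixes the erasure. An empty part would erase to an arbitrary arrow.\<close>

lemma erase_splits_aty:
  assumes "splits_aty \<tau> \<tau>1 \<tau>2" "wf_aty \<tau>" "wf_aty \<tau>1" "wf_aty \<tau>2"
  shows "erase_aty \<tau>1 = erase_aty \<tau> \<and> erase_aty \<tau>2 = erase_aty \<tau>"
  using assms
proof cases
  case (2 T1 T T2)
  then obtain A1 A2 where "A1 \<in> T1" "A2 \<in> T2" using assms by (auto simp: wf_arrows_def)
  then show ?thesis
    using 2 assms erase_Funs[of T1 A1] erase_Funs[of T2 A2] erase_Funs[of T A1] erase_Funs[of T A2]
    by auto
qed (auto dest: erase_splits)

definition erase_ctx :: "(var \<rightharpoonup> aty) \<Rightarrow> (var \<rightharpoonup> sty)" where
  "erase_ctx \<Gamma> x = map_option erase_aty (\<Gamma> x)"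

lemma erase_ctx_empty [simp]: "erase_ctx Map.empty = Map.empty"
  by (simp add: erase_ctx_def fun_eq_iff)

lemma erase_ctx_upd [simp]: "erase_ctx (\<Gamma>(x \<mapsto> \<tau>)) = (erase_ctx \<Gamma>)(x \<mapsto> erase_aty \<tau>)"
  by (simp add: erase_ctx_def fun_eq_iff)

lemma erase_ctx_add [simp]: "erase_ctx (\<Gamma> ++ \<Delta>) = erase_ctx \<Gamma> ++ erase_ctx \<Delta>"
  by (auto simp: erase_ctx_def map_add_def fun_eq_iff split: option.splits)

lemma dom_erase_ctx [simp]: "dom (erase_ctx \<Gamma>) = dom \<Gamma>"
  by (auto simp: erase_ctx_def dom_def)

text \<open>Every annotated rule turns into a simple rule or into an identity, so the program is
  typed once, with annotations, and its simple type follows.\<close>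

lemma simple_typing_erase:
  "aara m \<Gamma> q e \<tau> p \<Longrightarrow> simple_typing (erase_ctx \<Gamma>) e (erase_aty \<tau>)"
proof (induction rule: aara.induct)
  case (aara_Share x \<Gamma> x1 x2 \<tau> \<tau>1 \<tau>2 m q e b p)
  then have "wf_ctx (\<Gamma>(x1 \<mapsto> \<tau>1, x2 \<mapsto> \<tau>2))" by (blast dest: aara_wf)
  then have "wf_aty \<tau>1 \<and> wf_aty \<tau>2"
    using \<open>x1 \<noteq> x2\<close> by (auto simp: wf_ctx_def split: if_splits)
  with aara_Share erase_splits_aty[of \<tau> \<tau>1 \<tau>2] show ?case
    unfolding erase_ctx_upd by (intro st_Share) (auto simp del: fun_upd_apply)
next
  case (aara_Fun f \<Gamma> x T m e)
  then obtain A where A: "A \<in> T" by (auto simp: wf_arrows_def)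
  then obtain b1 q1 b2 q2 R where *: "A = Arrow (b1, q1) (b2, q2)" "R \<subseteq> T"
     "aara m (\<Gamma>(f \<mapsto> Funs (insert A R), x \<mapsto> Base b1)) q1 e (Base b2) q2"
     "simple_typing (erase_ctx (\<Gamma>(f \<mapsto> Funs (insert A R), x \<mapsto> Base b1))) e (erase_aty (Base b2))"
    using aara_Fun.IH by blast
  \<comment> \<open>The set of types for recursive calls and the set \<open>T\<close> both contain
    \<open>A\<close>. They therefore erase to the same arrow, as the simple rule for functions
    requires.\<close>
  have "wf_arrows (insert A R)"
    by (rule wf_arrows_subset[of T]) (use aara_Fun A * in auto)
  then have "erase_aty (Funs (insert A R)) = erase_arrow A"
    by (intro erase_Funs) auto
  moreover have "erase_aty (Funs T) = erase_arrow A"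
    by (intro erase_Funs) (use aara_Fun A in auto)
  ultimately show ?case
    using * aara_Fun.hyps
    by (simp del: erase_aty.simps(2) fun_upd_apply) (intro st_Fun; simp del: fun_upd_apply)
next
  case (aara_App f x T b1 q b2 p m)
  then have "erase_aty (Funs T) = erase_arrow (Arrow (b1, q) (b2, p))"
    by (intro erase_Funs)
  with aara_App show ?case
    by (simp del: erase_aty.simps(2) fun_upd_apply) (intro st_App; simp)
next
  case (aara_Weaken m \<Gamma> q e \<tau> p \<Gamma>')
  then have "erase_ctx \<Gamma> \<subseteq>\<^sub>m erase_ctx \<Gamma>'"
    by (auto simp: map_le_def erase_ctx_def)
  with aara_Weaken show ?case by (blast intro: st_Weaken)
next
  case (aara_SubResult m \<Gamma> q e \<tau> p \<tau>' p')
  then show ?case using erase_subtype_aty[of \<tau> \<tau>'] aara_wf[OF aara_SubResult(1)] by simp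
next
  case (aara_SubContext x \<Gamma> m \<tau> q e \<tau>' p \<tau>0)
  then show ?case
    using erase_subtype_aty[of \<tau>0 \<tau>] aara_wf[OF aara_SubContext(2)] wf_ctx_upd[of \<Gamma> x \<tau>]
    by (simp del: fun_upd_apply)
next
  case (aara_Let \<Gamma>1 \<Gamma>2 x m q e1 \<tau> r e2 b p)
  then show ?case
    unfolding erase_ctx_add erase_aty.simps
    by (intro st_Let) (auto simp del: fun_upd_apply)
next
  case (aara_CaseSum x \<Gamma> y m b1 q el b p b2 er)
  then show ?case
    unfolding erase_ctx_upd erase_aty.simps erase.simps
    by (intro st_CaseSum) (auto simp del: fun_upd_apply)
next
  case (aara_CasePair x \<Gamma> x1 x2 m b1 b2 q e b p)
  then show ?case
    unfolding erase_ctx_upd erase_aty.simps erase.simps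
    by (intro st_CasePair) (auto simp del: fun_upd_apply)
next
  case (aara_CaseList x \<Gamma> x1 x2 r b m q e0 b' p e1)
  then show ?case
    unfolding erase_ctx_upd erase_aty.simps erase.simps
    by (intro st_CaseList) (auto simp del: fun_upd_apply)
qed (simp_all del: fun_upd_apply add: st_Var st_Unit st_Tick st_InL st_InR st_Pair st_Nil st_Cons)

section \<open>Derived typing rules\<close>

lemma wf_ctx_empty: "wf_ctx Map.empty"
  by (simp add: wf_ctx_def)

lemmas wf_ctx_intros = wf_ctx_updI wf_ctx_empty

text \<open>Weakening is built into this rule and into the derived case rules below: the context
  only has to extend the parts in use. A name that is about to be rebound is dropped by leaving it
  out of \<open>\<Theta>\<close>.\<close>

lemma aara_let:
  fixes \<Delta> \<Theta>
  assumes "aara m \<Delta> q e1 \<tau> r" "aara m (\<Theta>(x \<mapsto> \<tau>)) r e2 (Base b) p"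
    "x \<notin> dom \<Theta>" "dom \<Delta> \<inter> dom \<Theta> = {}" "\<Delta> ++ \<Theta> \<subseteq>\<^sub>m \<Gamma>" "wf_ctx \<Gamma>"
  shows "aara m \<Gamma> q (ELet x e1 e2) (Base b) p"
  using aara_Weaken[OF aara_Let[OF assms(4,3,1,2)]] assms by blast

text \<open>Relaxation by the same amount before and after. In \<open>aara_let0\<close> it carries
  the potential for \<open>e2\<close> past a cost-free \<open>e1\<close>.\<close>

lemma aara_frame:
  assumes "aara m \<Gamma> q e \<tau> p" "0 \<le> r"
  shows "aara m \<Gamma> (q + r) e \<tau> (p + r)"
  using aara_Relax[OF assms(1), of "q + r" "p + r"] aara_wf[OF assms(1)] assms(2) by auto

lemma aara_let0:
  assumes "aara m \<Delta> 0 e1 \<tau> 0" "aara m (\<Theta>(x \<mapsto> \<tau>)) q e2 (Base b) p"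
    "x \<notin> dom \<Theta>" "dom \<Delta> \<inter> dom \<Theta> = {}" "\<Delta> ++ \<Theta> \<subseteq>\<^sub>m \<Gamma>" "wf_ctx \<Gamma>"
  shows "aara m \<Gamma> q (ELet x e1 e2) (Base b) p"
  using aara_let[of m \<Delta> q e1 \<tau> q \<Theta> x e2 b p \<Gamma>] aara_frame[OF assms(1), of q] assms
    aara_wf[OF assms(2)]
  by auto

lemma aara_casepair:
  assumes "aara m (\<Gamma>(x1 \<mapsto> Base b1, x2 \<mapsto> Base b2)) q e (Base b) p"
    "x \<notin> dom \<Gamma>" "x1 \<notin> dom \<Gamma>" "x2 \<notin> dom \<Gamma>" "x1 \<noteq> x2"
    "\<Gamma>(x \<mapsto> Base (AProd b1 b2)) \<subseteq>\<^sub>m \<Gamma>'" "wf_ctx \<Gamma>'"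
  shows "aara m \<Gamma>' q (ECasePair x x1 x2 e) (Base b) p"
  using aara_Weaken[OF aara_CasePair[OF assms(2-5,1)]] assms by blast

lemma aara_caselist:
  assumes "aara m \<Gamma> q e0 (Base b') p"
    "aara m (\<Gamma>(x1 \<mapsto> Base b, x2 \<mapsto> Base (AList (shift r) b))) (q + nth_default 0 r 0) e1 (Base b') p"
    "x \<notin> dom \<Gamma>" "x1 \<notin> dom \<Gamma>" "x2 \<notin> dom \<Gamma>" "x1 \<noteq> x2" "nonneg (AList r b)"
    "\<Gamma>(x \<mapsto> Base (AList r b)) \<subseteq>\<^sub>m \<Gamma>'" "wf_ctx \<Gamma>'"
  shows "aara m \<Gamma>' q (ECaseList x e0 x1 x2 e1) (Base b') p"
  using aara_Weaken[OF aara_CaseList[OF assms(3-7,1-2)]] assms by blast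

lemma shift_Nil [simp]: "shift [] = []"
  by (simp add: shift_def)

lemma aara_cons0:
  assumes "x1 \<noteq> x2" "nonneg b"
  shows "aara m [x1 \<mapsto> Base b, x2 \<mapsto> Base (AList [] b)] 0 (ECons x1 x2) (Base (AList [] b)) 0"
  using aara_Cons[of x1 x2 "[]" b m] assms by simp

lemma aara_caselist0:
  assumes "aara m \<Gamma> q e0 (Base b') p"
    "aara m (\<Gamma>(x1 \<mapsto> Base b, x2 \<mapsto> Base (AList [] b))) q e1 (Base b') p"
    "x \<notin> dom \<Gamma>" "x1 \<notin> dom \<Gamma>" "x2 \<notin> dom \<Gamma>" "x1 \<noteq> x2" "nonneg b"
    "\<Gamma>(x \<mapsto> Base (AList [] b)) \<subseteq>\<^sub>m \<Gamma>'" "wf_ctx \<Gamma>'"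
  shows "aara m \<Gamma>' q (ECaseList x e0 x1 x2 e1) (Base b') p"
  using aara_caselist[of m \<Gamma> q e0 b' p x1 b x2 "[]" e1 x \<Gamma>'] assms by simp

section \<open>Finite types\<close>

text \<open>The type \<open>fty n\<close> has \<open>n + 1\<close> values, and numbers above \<open>n\<close> are identified with \<open>n\<close>.
  Hence \<open>fconst n i\<close> is typable for every \<open>i\<close>, which covers the unreachable branches of a case
  analysis.\<close>

primrec fty :: "nat \<Rightarrow> abase" where
  "fty 0 = AUnit"
| "fty (Suc n) = ASum AUnit (fty n)"

fun fval :: "nat \<Rightarrow> nat \<Rightarrow> val" where
  "fval 0 i = VUnit"
| "fval (Suc n) 0 = VInL VUnit"
| "fval (Suc n) (Suc i) = VInR (fval n i)"

fun fconst :: "nat \<Rightarrow> nat \<Rightarrow> exp" where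
  "fconst 0 i = EUnit"
| "fconst (Suc n) 0 = ELet ''u'' EUnit (EInL ''u'')"
| "fconst (Suc n) (Suc i) = ELet ''u'' (fconst n i) (EInR ''u'')"

primrec fcase :: "nat \<Rightarrow> var \<Rightarrow> (nat \<Rightarrow> exp) \<Rightarrow> exp" where
  "fcase 0 y e = e 0"
| "fcase (Suc n) y e = ECaseSum y y (e 0) (fcase n y (\<lambda>i. e (Suc i)))"

lemma nonneg_fty [simp]: "nonneg (fty n)"
  by (induction n) auto

lemma aara_fconst: "aara m Map.empty 0 (fconst n i) (Base (fty n)) 0"
proof (induction n i rule: fconst.induct)
  case (2 n)
  then show ?case
    by (auto intro!: aara_let0[where \<Theta> = Map.empty] aara_Unit aara_InL wf_ctx_intros)
next
  case (3 n i)
  then show ?case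
    by (auto intro!: aara_let0[where \<Theta> = Map.empty] aara_InR wf_ctx_intros)
qed (auto intro: aara_Unit)

lemma eval_fconst: "eval E (fconst n i) (fval n i) 0"
  by (induction n i arbitrary: E rule: fconst.induct)
    (auto intro!: ev_Unit eval_let0 ev_InL ev_InR)

text \<open>The scrutinee is rebound under its own name at each level and ends as a unit, which
  weakening drops; so branches are typed without \<open>y\<close>. The hypothesis covers all
  \<open>i\<close> because the induction shifts \<open>e\<close>.\<close>

lemma aara_fcase_upd:
  assumes "\<And>i. aara m \<Gamma> q (e i) (Base b) p" "y \<notin> dom \<Gamma>"
  shows "aara m (\<Gamma>(y \<mapsto> Base (fty n))) q (fcase n y e) (Base b) p"
  using assms(1)
proof (induction n arbitrary: e)
  case 0
  then show ?case
    unfolding fcase.simps fty.simps using assms(2)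
    by (intro aara_Weaken[OF 0] wf_ctx_updI) (auto simp: map_le_def aara_wf[OF 0])
next
  case (Suc n)
  have "aara m (\<Gamma>(y \<mapsto> Base AUnit)) q (e 0) (Base b) p"
    using assms(2)
    by (intro aara_Weaken[OF Suc.prems] wf_ctx_updI) (auto simp: map_le_def aara_wf[OF Suc.prems])
  with Suc assms(2) show ?case
    unfolding fty.simps fcase.simps by (intro aara_CaseSum) (auto simp del: fun_upd_apply)
qed

lemma aara_fcase:
  assumes "\<And>i. aara m \<Gamma> q (e i) (Base b) p" "y \<notin> dom \<Gamma>"
    "\<Gamma>(y \<mapsto> Base (fty n)) \<subseteq>\<^sub>m \<Gamma>'" "wf_ctx \<Gamma>'"
  shows "aara m \<Gamma>' q (fcase n y e) (Base b) p"
  by (rule aara_Weaken[OF aara_fcase_upd]) (use assms in auto)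

lemma eval_fcase:
  assumes "E y = Some (fval n i)" "i \<le> n" "eval (E(y \<mapsto> VUnit)) (e i) r k"
  shows "eval E (fcase n y e) r k"
  using assms
proof (induction n arbitrary: E i e)
  case 0
  \<comment> \<open>The last level performs no case analysis, and \<open>y\<close> is already bound
    to the unit there.\<close>
  then have "E(y \<mapsto> VUnit) = E" by (auto simp: fun_eq_iff)
  with 0 show ?case by simp
next
  case (Suc n)
  show ?case
  proof (cases i)
    case 0
    with Suc.prems show ?thesis by (auto intro!: ev_CaseSumL simp del: fun_upd_apply)
  next
    case i: (Suc j)
    have "eval (E(y \<mapsto> fval n j)) (fcase n y (\<lambda>i. e (Suc i))) r k"
      by (rule Suc.IH[of _ j]) (use Suc.prems i in \<open>auto simp del: fun_upd_apply simp: fun_upd_same\<close>)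
    with Suc.prems i show ?thesis
      unfolding fcase.simps by (intro ev_CaseSumR) (auto simp del: fun_upd_apply)
  qed
qed

section \<open>Folding over a list\<close>

primrec vlist :: "val list \<Rightarrow> val" where
  "vlist [] = VNil"
| "vlist (v # vs) = VCons v (vlist vs)"

text \<open>Functions take one argument and capture no potential, so list and accumulator travel
  together as a pair. The tail is shared: the copy \<open>t\<close> is for \<open>e\<close>, which
  may itself loop over it, and the copy \<open>l\<close> is for the recursive call.\<close>

definition efold :: "exp \<Rightarrow> exp \<Rightarrow> exp" where
  "efold e0 e = ELet ''f'' (EFun ''f'' ''x'' (ECasePair ''x'' ''l'' ''a''
     (ECaseList ''l'' e0 ''h'' ''t'' (EShare ''t'' ''t'' ''l''
        (ELet ''a'' e (ELet ''x'' (EPair ''l'' ''a'') (EApp ''f'' ''x'')))))))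
     (EApp ''f'' ''x'')"

text \<open>Matching on the list releases the first coefficient of \<open>r\<close>, which pays for
  \<open>e\<close>. The tail then carries \<open>shift r\<close>, which splits into \<open>p\<close>
  for \<open>e\<close> and \<open>r\<close> for the recursive call. The constant \<open>q\<close> is
  passed along until \<open>e0\<close> consumes it.\<close>

lemma aara_efold:
  assumes e0: "aara Ticks [''a'' \<mapsto> Base c] q e0 (Base c) 0"
    and e: "aara Ticks [''h'' \<mapsto> Base b, ''t'' \<mapsto> Base (AList p b), ''a'' \<mapsto> Base c]
              (nth_default 0 r 0) e (Base c) 0"
    and sp: "splits (AList (shift r) b) (AList p b) (AList r b)"
    and nn: "nonneg (AList r b)"
  shows "aara Ticks [''x'' \<mapsto> Base (AProd (AList r b) c)] q (efold e0 e) (Base c) 0"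
proof -
  define A where "A = Arrow (AProd (AList r b) c, q) (c, 0)"
  have c: "nonneg c" and q: "0 \<le> q" using aara_wf[OF e0] by (auto simp: wf_ctx_def)
  have p: "nonneg (AList p b)"
    using aara_wf[OF e] unfolding wf_ctx_def by (auto split: if_splits)
  have sh: "nonneg (AList (shift r) b)" using nonneg_shift[of r] nn by simp
  have A: "wf_arrows {A}" using c q nn by (auto simp: wf_arrows_def A_def)
  note nns = c q nn p sh A
  have rec: "aara Ticks [''f'' \<mapsto> Funs {A}, ''l'' \<mapsto> Base (AList r b), ''a'' \<mapsto> Base c] q
     (ELet ''x'' (EPair ''l'' ''a'') (EApp ''f'' ''x'')) (Base c) 0"
    by (rule aara_let0[where \<Theta> = "[''f'' \<mapsto> Funs {A}]"], rule aara_Pair)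
      (use nns in \<open>auto intro!: wf_ctx_intros aara_App simp: A_def map_le_def\<close>)
  \<comment> \<open>The potential \<open>q\<close> is framed around \<open>e\<close> and reaches the
    recursive call untouched.\<close>
  have cons: "aara Ticks [''f'' \<mapsto> Funs {A}, ''a'' \<mapsto> Base c, ''h'' \<mapsto> Base b,
       ''t'' \<mapsto> Base (AList p b), ''l'' \<mapsto> Base (AList r b)] (q + nth_default 0 r 0)
     (ELet ''a'' e (ELet ''x'' (EPair ''l'' ''a'') (EApp ''f'' ''x''))) (Base c) 0"
    by (rule aara_let[where \<Theta> = "[''f'' \<mapsto> Funs {A}, ''l'' \<mapsto> Base (AList r b)]" and r = "0 + q"],
        subst add.commute, rule aara_frame[OF e q], simp add: rec)
      (use nns in \<open>auto intro!: wf_ctx_intros simp: map_le_def\<close>)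
  have sh: "aara Ticks [''f'' \<mapsto> Funs {A}, ''a'' \<mapsto> Base c, ''h'' \<mapsto> Base b,
       ''t'' \<mapsto> Base (AList (shift r) b)] (q + nth_default 0 r 0)
     (EShare ''t'' ''t'' ''l'' (ELet ''a'' e (ELet ''x'' (EPair ''l'' ''a'') (EApp ''f'' ''x''))))
     (Base c) 0"
    by (rule aara_Share) (use cons sp nns in \<open>auto intro: splits_aty.intros\<close>)
  have nil: "aara Ticks [''f'' \<mapsto> Funs {A}, ''a'' \<mapsto> Base c] q e0 (Base c) 0"
    by (rule aara_Weaken[OF e0]) (use nns in \<open>auto intro!: wf_ctx_intros simp: map_le_def\<close>)
  \<comment> \<open>Written with \<open>insert A {}\<close> to match the rule for functions at
    \<open>R = {}\<close>: the body is derived with recursive calls at \<open>A\<close>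
    alone.\<close>
  have body: "aara Ticks [''f'' \<mapsto> Funs (insert A {}), ''x'' \<mapsto> Base (AProd (AList r b) c)] q
     (ECasePair ''x'' ''l'' ''a''
       (ECaseList ''l'' e0 ''h'' ''t'' (EShare ''t'' ''t'' ''l''
        (ELet ''a'' e (ELet ''x'' (EPair ''l'' ''a'') (EApp ''f'' ''x'')))))) (Base c) 0"
    by (rule aara_casepair[where \<Gamma> = "[''f'' \<mapsto> Funs {A}]"],
        rule aara_caselist[where \<Gamma> = "[''f'' \<mapsto> Funs {A}, ''a'' \<mapsto> Base c]"], rule nil, rule sh)
      (use nns in \<open>auto intro!: wf_ctx_intros simp: map_le_def\<close>)
  have "aara Ticks Map.empty 0 (EFun ''f'' ''x'' (ECasePair ''x'' ''l'' ''a''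
       (ECaseList ''l'' e0 ''h'' ''t'' (EShare ''t'' ''t'' ''l''
        (ELet ''a'' e (ELet ''x'' (EPair ''l'' ''a'') (EApp ''f'' ''x''))))))) (Funs {A}) 0"
  proof (rule aara_Fun)
    show "zero_ctx Map.empty" by (simp add: zero_ctx_def)
  qed (use A body in \<open>auto simp: A_def simp del: fun_upd_apply intro!: exI[of _ "{}"]\<close>)
  moreover have "aara Ticks [''x'' \<mapsto> Base (AProd (AList r b) c), ''f'' \<mapsto> Funs {A}] q
      (EApp ''f'' ''x'') (Base c) 0"
    by (subst fun_upd_twist, simp, rule aara_App) (use A in \<open>auto simp: A_def\<close>)
  ultimately show ?thesis
    unfolding efold_def
    by (rule aara_let0) (use nns in \<open>auto intro!: wf_ctx_intros\<close>)
qed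

text \<open>A paramorphism in accumulator style: unlike in \<open>fold\<close>, the step function
  also sees the remaining list.\<close>

primrec pfold :: "('a \<Rightarrow> 'a list \<Rightarrow> 'c \<Rightarrow> 'c) \<Rightarrow> ('c \<Rightarrow> 'c) \<Rightarrow> 'a list \<Rightarrow> 'c \<Rightarrow> 'c" where
  "pfold g z [] c = z c"
| "pfold g z (h # t) c = pfold g z t (g h t c)"

lemma pfold_fold: "pfold (\<lambda>h t. g h) (\<lambda>c. c) xs c = fold g xs c"
  by (induction xs arbitrary: c) auto

text \<open>The sets \<open>A\<close> and \<open>C\<close> are invariants of entries and
  accumulators, since the loop bodies are only correct on valid codes and configurations. The cost
  \<open>kb\<close> depends on the length of the tail alone, and the tails have the lengths below
  \<open>length xs\<close>.\<close>

lemma eval_efold: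
  assumes e0: "\<And>E c. c \<in> C \<Longrightarrow> E ''a'' = Some (ec c) \<Longrightarrow> eval E e0 (ec (z c)) k0"
    and e: "\<And>E h t c. h \<in> A \<Longrightarrow> set t \<subseteq> A \<Longrightarrow> c \<in> C \<Longrightarrow> E ''h'' = Some (ea h) \<Longrightarrow>
       E ''t'' = Some (vlist (map ea t)) \<Longrightarrow> E ''a'' = Some (ec c) \<Longrightarrow>
       eval E e (ec (g h t c)) (kb (length t))"
    and g: "\<And>h t c. h \<in> A \<Longrightarrow> set t \<subseteq> A \<Longrightarrow> c \<in> C \<Longrightarrow> g h t c \<in> C"
    and xs: "set xs \<subseteq> A" and c: "c \<in> C"
    and E: "E ''x'' = Some (VPair (vlist (map ea xs)) (ec c))"
  shows "eval E (efold e0 e) (ec (pfold g z xs c)) (k0 + (\<Sum>i<length xs. kb i))"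
proof -
  define B where "B = ECasePair ''x'' ''l'' ''a''
     (ECaseList ''l'' e0 ''h'' ''t'' (EShare ''t'' ''t'' ''l''
        (ELet ''a'' e (ELet ''x'' (EPair ''l'' ''a'') (EApp ''f'' ''x'')))))"
  define F where "F = VClosure E ''f'' ''x'' B"
  \<comment> \<open>The induction is on the body of the closure. Each recursive call enters it in
    the captured environment \<open>E\<close> with new bindings of \<open>f\<close> and
    \<open>x\<close>, so only these two bindings of \<open>E'\<close> may be assumed.\<close>
  have *: "eval E' B (ec (pfold g z xs c)) (k0 + (\<Sum>i<length xs. kb i))"
    if "E' ''f'' = Some F" "E' ''x'' = Some (VPair (vlist (map ea xs)) (ec c))"
    for E'
    using that xs c
  proof (induction xs arbitrary: E' c)
    case Nil
    then show ?case
      unfolding B_def by (auto intro!: ev_CasePair ev_CaseNil e0)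
  next
    case (Cons h t)
    have app: "eval E'' (EApp ''f'' ''x'') (ec (pfold g z t (g h t c))) (k0 + (\<Sum>i<length t. kb i))"
      if "E'' ''f'' = Some F" "E'' ''x'' = Some (VPair (vlist (map ea t)) (ec (g h t c)))" for E''
      by (rule ev_App[where E' = E and g = "''f''" and y = "''x''" and e = B])
        (use that Cons in \<open>auto intro!: Cons.IH g simp: F_def\<close>)
    have k: "k0 + (\<Sum>i<length (h # t). kb i) = kb (length t) + (k0 + (\<Sum>i<length t. kb i))"
      by simp
    define G where "G = ec (g h t c)"
    define E0 where
      "E0 = E'(''l'' \<mapsto> vlist (map ea t), ''a'' \<mapsto> ec c, ''h'' \<mapsto> ea h, ''t'' \<mapsto> vlist (map ea t))"
    have "eval E0 e G (kb (length t))"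
      unfolding G_def by (rule e) (use Cons.prems in \<open>auto simp: E0_def\<close>)
    moreover have "eval (E0(''a'' \<mapsto> G)) (ELet ''x'' (EPair ''l'' ''a'') (EApp ''f'' ''x''))
        (ec (pfold g z t (g h t c))) (k0 + (\<Sum>i<length t. kb i))"
      by (rule eval_let0, rule ev_Pair[of _ _ "vlist (map ea t)" _ G], rule_tac [3] app)
        (use Cons.prems in \<open>auto simp: E0_def G_def\<close>)
    ultimately have "eval E0 (ELet ''a'' e (ELet ''x'' (EPair ''l'' ''a'') (EApp ''f'' ''x'')))
        (ec (pfold g z (h # t) c)) (k0 + (\<Sum>i<length (h # t). kb i))"
      unfolding k pfold.simps by (rule ev_Let)
    \<comment> \<open>Sharing overwrites the matched list in \<open>l\<close> by its tail.\<close>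
    moreover have "E'(''l'' \<mapsto> VCons (ea h) (vlist (map ea t)), ''a'' \<mapsto> ec c, ''h'' \<mapsto> ea h,
        ''t'' \<mapsto> vlist (map ea t), ''l'' \<mapsto> vlist (map ea t)) = E0"
      by (auto simp: E0_def)
    ultimately show ?case
      unfolding B_def using Cons.prems
      by (intro ev_CasePair[where x = "''x''"] ev_CaseCons ev_Share)
        (auto simp del: fun_upd_apply simp: fun_upd_same fun_upd_other)
  qed
  show ?thesis
    unfolding efold_def B_def[symmetric]
    by (rule eval_let0, rule ev_Fun,
        rule ev_App[where E' = E and g = "''f''" and y = "''x''" and e = B])
      (auto simp: E F_def[symmetric] intro!: *)
qed

section \<open>Iterating a step along a list\<close>

text \<open>In closed form, \<open>iters k n\<close> is the sum of the binomial coefficients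
  \<open>n choose i\<close> over \<open>i \<le> k\<close>. Hence \<open>N * iters k n\<close> is
  exactly the potential of the annotation \<open>replicate k N\<close> on a list of length
  \<open>n\<close> plus the constant \<open>N\<close>.\<close>

primrec iters :: "nat \<Rightarrow> nat \<Rightarrow> nat" where
  "iters 0 n = 1"
| "iters (Suc k) n = 1 + (\<Sum>i<n. iters k i)"

lemma iters_pos: "1 \<le> iters k n"
  by (cases k) auto

lemma iters_mono: "iters k n \<le> iters (Suc k) n"
proof (induction k arbitrary: n)
  case (Suc k)
  then show ?case by (auto intro!: sum_mono simp del: iters.simps(2) simp: iters.simps(2)[of "Suc k"] iters.simps(2)[of k n])
qed simp

text \<open>A factor \<open>n\<close> raises the order by one at the price of a constant, which is
  what Horner's scheme needs in \<open>poly_le_iters\<close>. The induction on \<open>n\<close>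
  keeps \<open>k\<close> general because the step uses the hypothesis at \<open>k\<close> and at
  \<open>k - 1\<close>.\<close>

lemma mult_iters_le: "n * iters k n \<le> (2 * k + 1) * iters (Suc k) n"
proof (induction n arbitrary: k)
  case (Suc n)
  show ?case
  proof (cases k)
    case (Suc j)
    \<comment> \<open>Pascal's rule, \<open>iters k (Suc n) = iters j n + iters k n\<close> for
      \<open>k = Suc j\<close>.\<close>
    have "Suc n * iters k (Suc n) = n * iters j n + n * iters k n + iters j n + iters k n"
      using Suc by (simp add: algebra_simps)
    also have "\<dots> \<le> (2 * j + 1) * iters k n + (2 * k + 1) * iters (Suc k) n + iters k n + iters k n"
      using Suc.IH[of j] Suc.IH[of k] iters_mono[of j n] Suc by (intro add_mono) auto
    \<comment> \<open>The constant fits because \<open>2 * j + 1\<close> plus the two extra copies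
      of \<open>iters k n\<close> is \<open>2 * k + 1\<close>.\<close>
    also have "\<dots> = (2 * k + 1) * iters (Suc k) (Suc n)"
      using Suc by (simp add: algebra_simps)
    finally show ?thesis .
  qed simp
qed simp

text \<open>Induction along Horner's scheme: \<open>n * poly p n\<close> is bounded one order
  higher, and the coefficient \<open>a\<close> is absorbed because \<open>iters\<close> is at least
  1.\<close>

lemma poly_le_iters:
  fixes p :: "nat poly"
  shows "\<exists>N k. \<forall>n. poly p n \<le> N * iters k n"
proof (induction p)
  case 0
  show ?case by simp
next
  case (pCons a p)
  then obtain N k where *: "poly p n \<le> N * iters k n" for n by blast
  have "poly (pCons a p) n \<le> (a + N * (2 * k + 1)) * iters (Suc k) n" for n
  proof -
    have "n * poly p n \<le> N * (n * iters k n)"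
      using mult_le_mono2[OF *, of n n] by (simp add: algebra_simps)
    also have "\<dots> \<le> N * ((2 * k + 1) * iters (Suc k) n)"
      by (intro mult_le_mono2 mult_iters_le)
    finally have "n * poly p n \<le> N * ((2 * k + 1) * iters (Suc k) n)" .
    moreover have "a \<le> a * iters (Suc k) n"
      using mult_le_mono2[OF iters_pos[of "Suc k" n], of a] by (simp only: mult_1_right)
    ultimately have "n * poly p n + a \<le> N * ((2 * k + 1) * iters (Suc k) n) + a * iters (Suc k) n"
      by (rule add_mono)
    then show ?thesis by (simp add: algebra_simps del: iters.simps)
  qed
  then show ?case by blast
qed

section \<open>The nested loop that drives the simulation\<close>

definition burst :: "nat \<Rightarrow> exp \<Rightarrow> exp" where
  "burst N e = ELet ''u'' (ETick (of_nat N)) ((ELet ''a'' e ^^ N) (EVar ''a''))"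

text \<open>A burst pays \<open>N\<close> ticks at once and then runs \<open>N\<close> unrolled
  tick-free copies of the step. At depth \<open>Suc k\<close> the loop body runs the program of
  depth \<open>k\<close> on the tail, and one more burst closes the list; this is the recursion of
  \<open>iters\<close>.\<close>

primrec iter_exp :: "nat \<Rightarrow> exp \<Rightarrow> nat \<Rightarrow> exp" where
  "iter_exp N e 0 = ECasePair ''x'' ''l'' ''a'' (burst N e)"
| "iter_exp N e (Suc k) =
     efold (burst N e) (ELet ''x'' (EPair ''t'' ''a'') (iter_exp N e k))"

lemma aara_burst:
  assumes e: "aara Ticks [''a'' \<mapsto> Base c] 0 e (Base c) 0"
  shows "aara Ticks [''a'' \<mapsto> Base c] (of_nat N) (burst N e) (Base c) 0"
proof -
  have c: "nonneg c" using aara_wf[OF e] by simp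
  have "aara Ticks [''a'' \<mapsto> Base c] 0 ((ELet ''a'' e ^^ n) (EVar ''a'')) (Base c) 0" for n
  proof (induction n)
    case 0
    show ?case using aara_Var[of "Base c" Ticks "''a''"] c by (simp del: fun_upd_apply)
  next
    case (Suc n)
    show ?case
      unfolding funpow.simps comp_apply
      by (rule aara_let0[where \<Delta> = "[''a'' \<mapsto> Base c]" and \<Theta> = Map.empty, OF e Suc])
        (use c in \<open>auto intro!: wf_ctx_intros simp del: fun_upd_apply\<close>)
  qed
  then have "aara Ticks [''a'' \<mapsto> Base c, ''u'' \<mapsto> Base AUnit] 0
      ((ELet ''a'' e ^^ N) (EVar ''a'')) (Base c) 0"
    by (rule aara_Weaken) (use c in \<open>auto intro!: wf_ctx_intros simp: map_le_def\<close>)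
  moreover have "aara Ticks Map.empty (of_nat N) (ETick (of_nat N)) (Base AUnit) 0"
    using aara_Tick[of Ticks "of_nat N"] by simp
  ultimately show ?thesis
    unfolding burst_def
    by (intro aara_let[where \<Theta> = "[''a'' \<mapsto> Base c]"]) (use c in \<open>auto intro!: wf_ctx_intros\<close>)
qed

lemma eval_burst:
  assumes e: "\<And>E c. c \<in> C \<Longrightarrow> E ''a'' = Some (ec c) \<Longrightarrow> eval E e (ec (S c)) 0"
    and S: "\<And>c. c \<in> C \<Longrightarrow> S c \<in> C" and c: "c \<in> C" and E: "E ''a'' = Some (ec c)"
  shows "eval E (burst N e) (ec ((S ^^ N) c)) (of_nat N)"
proof -
  have "eval E ((ELet ''a'' e ^^ n) (EVar ''a'')) (ec ((S ^^ n) c)) 0"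
    if "c \<in> C" "E ''a'' = Some (ec c)" for n E c
    using that
  proof (induction n arbitrary: E c)
    case (Suc n)
    have "eval (E(''a'' \<mapsto> ec (S c))) ((ELet ''a'' e ^^ n) (EVar ''a'')) (ec ((S ^^ n) (S c))) 0"
      by (rule Suc.IH) (use Suc.prems S in auto)
    moreover have "eval E e (ec (S c)) 0" using Suc.prems by (intro e)
    moreover have "(S ^^ Suc n) c = (S ^^ n) (S c)" by (simp add: funpow_swap1)
    ultimately show ?case by (auto intro: eval_let0 simp del: fun_upd_apply)
  qed (auto intro: ev_Var)
  from this[OF c, of "E(''u'' \<mapsto> VUnit)" N]
  show ?thesis
    unfolding burst_def using E ev_Let[OF ev_Tick[of E "of_nat N"]] by fastforce
qed

text \<open>The shifted vector is \<open>(2x, ..., 2x, x)\<close>, because its last entry is added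
  to the padding zero. The assumption on \<open>b\<close> forces its annotations to be zero.\<close>

lemma splits_replicate:
  assumes "splits b b b"
  shows "splits (AList (shift (replicate (Suc k) (x :: rat))) b)
    (AList (replicate k x) b) (AList (replicate (Suc k) x) b)"
proof -
  have "nth_default 0 (shift (replicate (Suc k) x)) i =
      nth_default 0 (replicate k x) i + nth_default 0 (replicate (Suc k) x) i" for i
    by (auto simp: nth_default_def shift_def nth_append simp del: replicate_Suc
        simp: replicate_Suc[THEN arg_cong[of _ _ tl]])
  then show ?thesis using assms by (auto intro: splits.intros)
qed

text \<open>In the inner program the list annotation is the part split off the shifted tail, and the
  constant \<open>N\<close> is paid by the coefficient released at the match. The closing burst uses
  the constant of the loop itself.\<close>

lemma aara_iter:
  assumes e: "aara Ticks [''a'' \<mapsto> Base c] 0 e (Base c) 0"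
    and b: "nonneg b" "splits b b b"
  shows "aara Ticks [''x'' \<mapsto> Base (AProd (AList (replicate k (of_nat N)) b) c)] (of_nat N)
    (iter_exp N e k) (Base c) 0"
proof (induction k)
  case 0
  have c: "nonneg c" using aara_wf[OF e] by simp
  have "aara Ticks [''l'' \<mapsto> Base (AList [] b), ''a'' \<mapsto> Base c] (of_nat N) (burst N e) (Base c) 0"
    by (rule aara_Weaken[OF aara_burst[OF e]])
      (use b c in \<open>auto intro!: wf_ctx_intros simp: map_le_def\<close>)
  then show ?case
    unfolding iter_exp.simps replicate_0
    by (rule aara_casepair[where \<Gamma> = Map.empty])
      (use b c in \<open>auto intro!: wf_ctx_intros simp del: fun_upd_apply\<close>)
next
  case (Suc k)
  have c: "nonneg c" using aara_wf[OF e] by simp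
  have "aara Ticks [''h'' \<mapsto> Base b, ''t'' \<mapsto> Base (AList (replicate k (of_nat N)) b), ''a'' \<mapsto> Base c]
      (of_nat N) (ELet ''x'' (EPair ''t'' ''a'') (iter_exp N e k)) (Base c) 0"
    by (rule aara_let0[OF aara_Pair Suc])
      (use b c in \<open>auto intro!: wf_ctx_intros simp: map_le_def\<close>)
  moreover have "nth_default 0 (replicate (Suc k) (of_nat N)) 0 = (of_nat N :: rat)"
    by (simp add: nth_default_def)
  ultimately show ?case
    unfolding iter_exp.simps
    by (intro aara_efold[OF aara_burst[OF e] _ splits_replicate[OF b(2)]])
      (use b in \<open>auto simp del: fun_upd_apply\<close>)
qed

lemma eval_iter:
  assumes e: "\<And>E c. c \<in> C \<Longrightarrow> E ''a'' = Some (ec c) \<Longrightarrow> eval E e (ec (S c)) 0"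
    and S: "\<And>c. c \<in> C \<Longrightarrow> S c \<in> C" and c: "c \<in> C"
    and E: "E ''x'' = Some (VPair (vlist (map ea xs)) (ec c))"
  shows "eval E (iter_exp N e k) (ec ((S ^^ (N * iters k (length xs))) c))
    (of_nat (N * iters k (length xs)))"
  using c E
proof (induction k arbitrary: E xs c)
  case 0
  then show ?case
    by (auto intro!: ev_CasePair eval_burst[where C = C] e S)
next
  case (Suc k)
  have closed: "(S ^^ n) c \<in> C" if "c \<in> C" for n c
    using that S by (induction n) auto
  \<comment> \<open>Running bursts in sequence adds their exponents: one exponent for each proper
    tail and one for the end of the list.\<close>
  have "pfold (\<lambda>h t. S ^^ (N * iters k (length t))) (S ^^ N) xs c
      = (S ^^ (N * iters (Suc k) (length xs))) c" for xs :: "'b list" and c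
    by (induction xs arbitrary: c) (auto simp: funpow_add[THEN fun_cong, symmetric, simplified] algebra_simps)
  moreover have "of_nat N + (\<Sum>i<length xs. of_nat (N * iters k i))
      = (of_nat (N * iters (Suc k) (length xs)) :: rat)"
    by (simp add: sum_distrib_left algebra_simps)
  moreover have "eval E (iter_exp N e (Suc k))
      (ec (pfold (\<lambda>h t. S ^^ (N * iters k (length t))) (S ^^ N) xs c))
      (of_nat N + (\<Sum>i<length xs. of_nat (N * iters k i)))"
    unfolding iter_exp.simps
  proof (rule eval_efold[where C = C and A = UNIV and ea = ea])
    fix E h t c
    assume *: "c \<in> C" "E ''t'' = Some (vlist (map ea t))" "E ''a'' = Some (ec c)"
    show "eval E (ELet ''x'' (EPair ''t'' ''a'') (iter_exp N e k))
        (ec ((S ^^ (N * iters k (length t))) c)) (of_nat (N * iters k (length t)))"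
      by (rule eval_let0, rule ev_Pair, rule *, rule *, rule Suc.IH) (use * in auto)
  qed (use Suc.prems closed in \<open>auto intro!: eval_burst[where C = C] e S\<close>)
  ultimately show ?case by simp
qed

section \<open>Zipper configurations\<close>

definition code :: "'x set \<Rightarrow> 'x \<Rightarrow> nat" where
  "code X = (SOME f. bij_betw f X {..<card X})"

text \<open>The weak bound suits \<open>fty (card X)\<close>, which has \<open>card X + 1\<close>
  values; a number that is no code decodes to an unspecified element.\<close>

lemma code:
  assumes "finite X" "x \<in> X"
  shows "code X x \<le> card X" "inv_into X (code X) (code X x) = x"
proof -
  have "\<exists>f. bij_betw f X {..<card X}"
    using ex_bij_betw_finite_nat[OF assms(1)] by (simp add: atLeast0LessThan)
  then have "bij_betw (code X) X {..<card X}"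
    unfolding code_def by (rule someI_ex)
  moreover from this have "code X x < card X"
    using assms(2) by (auto simp: bij_betw_def)
  ultimately show "code X x \<le> card X" "inv_into X (code X) (code X x) = x"
    using assms by (auto simp: bij_betw_def intro: less_imp_le)
qed

text \<open>\<open>(q, ls, rs)\<close> stands for the state \<open>q\<close>, the cells to the left of the head, nearest first, and
  the cells from the head on, where cells beyond the end of \<open>rs\<close> are blank. A final configuration
  is kept up to padding with a blank, so that the step can be iterated after termination.\<close>

type_synonym ('q, 'a) zipper = "'q \<times> 'a list \<times> 'a list"

definition zstep :: "('q, 'a) tm \<Rightarrow> ('q, 'a) zipper \<Rightarrow> ('q, 'a) zipper" where
  "zstep M = (\<lambda>(q, ls, rs).
     let a = (case rs of [] \<Rightarrow> blank M | a # _ \<Rightarrow> a); r = tl rs in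
     if q = final M then (q, ls, a # r)
     else case delta M q a of
       (q', a', MoveR) \<Rightarrow> (q', a' # ls, r)
     | (q', a', MoveL) \<Rightarrow> (case ls of [] \<Rightarrow> (q', [], a' # r) | b # ls' \<Rightarrow> (q', ls', b # a' # r)))"

definition zippers :: "('q, 'a) tm \<Rightarrow> ('q, 'a) zipper set" where
  "zippers M = states M \<times> lists (tape_alphabet M) \<times> lists (tape_alphabet M)"

text \<open>The tape fixes \<open>ls\<close>, but \<open>rs\<close> only up to trailing blanks. The
  clause \<open>t 0 = left_end M\<close> rules out a left move from cell 0 in a non-final state of a
  Turing machine.\<close>

definition zrep :: "('q, 'a) tm \<Rightarrow> ('q, 'a) config \<Rightarrow> ('q, 'a) zipper \<Rightarrow> bool" where
  "zrep M = (\<lambda>(q, t, h) (q', ls, rs). q' = q \<and> ls = map t (rev [0..<h]) \<and>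
     (\<forall>j. t (h + j) = nth_default (blank M) rs j) \<and> t 0 = left_end M)"

lemma turing_machineD:
  assumes "turing_machine M"
  shows "finite (states M)" "finite (tape_alphabet M)"
    "bit_sym M b \<in> tape_alphabet M" "left_end M \<in> tape_alphabet M" "blank M \<in> tape_alphabet M"
    "start M \<in> states M"
    "q \<in> states M \<Longrightarrow> a \<in> tape_alphabet M \<Longrightarrow> delta M q a \<in> states M \<times> tape_alphabet M \<times> UNIV"
    "q \<in> states M \<Longrightarrow> q \<noteq> final M \<Longrightarrow> \<exists>q'. delta M q (left_end M) = (q', left_end M, MoveR)"
  using assms by (auto simp: turing_machine_def)

text \<open>Codes are inverted only on \<open>states M\<close> and \<open>tape_alphabet M\<close>,
  so the compiled step is verified on \<open>zippers M\<close>, and iterating it requires this set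
  to be invariant.\<close>

lemma zstep_closed:
  assumes M: "turing_machine M" and z: "z \<in> zippers M"
  shows "zstep M z \<in> zippers M"
proof -
  obtain q ls rs where z_eq: "z = (q, ls, rs)" by (cases z)
  define a where "a = (case rs of [] \<Rightarrow> blank M | a # _ \<Rightarrow> a)"
  have "set (tl rs) \<subseteq> set rs" by (cases rs) auto
  then have q: "q \<in> states M" and ls: "set ls \<subseteq> tape_alphabet M" and rs: "set (tl rs) \<subseteq> tape_alphabet M"
    and a: "a \<in> tape_alphabet M"
    using z turing_machineD(5)[OF M] by (auto simp: zippers_def z_eq a_def in_lists_conv_set split: list.splits)
  obtain q' a' d where d: "delta M q a = (q', a', d)" by (cases "delta M q a")
  then have "q' \<in> states M" "a' \<in> tape_alphabet M"
    using turing_machineD(7)[OF M q a] by auto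
  then show ?thesis
    using q ls rs a d unfolding z_eq zstep_def a_def[symmetric] zippers_def
    by (auto simp: a_def[symmetric] Let_def in_lists_conv_set split: dir.splits list.splits)
qed

lemma zstep_tm_step:
  assumes M: "turing_machine M" and q: "q \<in> states M" "q \<noteq> final M"
    and rep: "zrep M (q, t, h) z"
  shows "zrep M (tm_step M (q, t, h)) (zstep M z)"
proof -
  obtain ls rs where z: "z = (q, ls, rs)" and ls: "ls = map t (rev [0..<h])"
    and rs: "\<And>j. t (h + j) = nth_default (blank M) rs j" and t0: "t 0 = left_end M"
    using rep by (cases z) (auto simp: zrep_def)
  have a: "(case rs of [] \<Rightarrow> blank M | a # _ \<Rightarrow> a) = t h"
    using rs[of 0] by (cases rs) auto
  have tl: "t (Suc (h + j)) = nth_default (blank M) (tl rs) j" for j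
    using rs[of "Suc j"] by (cases rs) auto
  obtain q' a' d where d: "delta M q (t h) = (q', a', d)" by (cases "delta M q (t h)")
  \<comment> \<open>On the end marker the machine rewrites it and moves right. So cell 0 is
    preserved, and a left move starts from some \<open>Suc h'\<close>.\<close>
  have h0: "a' = left_end M \<and> d = MoveR" if "h = 0"
    using that d t0 turing_machineD(8)[OF M q] by auto
  show ?thesis
  proof (cases d)
    case MoveR
    then show ?thesis
      using q h0 d tl by (auto simp: z zstep_def Let_def a tm_step_def zrep_def ls t0)
  next
    case MoveL
    then obtain h' where h: "h = Suc h'" using h0 by (cases h) auto
    have "(t(h := a')) (h' + j) = nth_default (blank M) (t h' # a' # tl rs) j" for j
    proof (cases j)
      case (Suc i)
      then show ?thesis using tl by (cases i) (auto simp: h)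
    qed (auto simp: h)
    then show ?thesis
      using MoveL q d by (auto simp: z zstep_def Let_def a tm_step_def zrep_def ls t0 h)
  qed
qed

section \<open>Compiling a Turing machine\<close>

abbreviation tape_ty :: "nat \<Rightarrow> abase" where
  "tape_ty n \<equiv> AList [] (fty n)"

definition push :: "nat \<Rightarrow> nat \<Rightarrow> var \<Rightarrow> exp \<Rightarrow> exp" where
  "push n i x e = ELet ''h'' (fconst n i) (ELet x (ECons ''h'' x) e)"

definition fold_onto :: "var \<Rightarrow> var \<Rightarrow> exp \<Rightarrow> exp" where
  "fold_onto y z e = ELet ''x'' (EPair y z) (efold (EVar ''a'') e)"

lemma aara_push:
  assumes "aara m \<Gamma> 0 e (Base b) 0" "\<Gamma> x = Some (Base (tape_ty n))" "\<Gamma> ''h'' = None"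
  shows "aara m \<Gamma> 0 (push n i x e) (Base b) 0"
proof -
  have x: "x \<noteq> ''h''" using assms by auto
  have wf: "wf_ctx \<Gamma>" using aara_wf[OF assms(1)] by simp
  have wf': "wf_ctx (\<Gamma>(''h'' \<mapsto> Base (fty n)))"
    using wf by (intro wf_ctx_intros) auto
  \<comment> \<open>The context is split at \<open>x\<close>: the old list is consumed by the cons,
    and the rest receives the new list under the same name.\<close>
  have "\<Gamma>(x := None, x \<mapsto> Base (tape_ty n)) = \<Gamma>" using assms(2) by auto
  then have e: "aara m (\<Gamma>(x := None, x \<mapsto> Base (tape_ty n))) 0 e (Base b) 0"
    using assms(1) by simp
  have "aara m (\<Gamma>(''h'' \<mapsto> Base (fty n))) 0 (ELet x (ECons ''h'' x) e) (Base b) 0"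
    by (rule aara_let0[OF aara_cons0 e])
      (use assms(2,3) x wf' in \<open>auto simp: map_le_def map_add_def split: option.splits if_splits\<close>)
  then show ?thesis
    unfolding push_def
    by (rule aara_let0[OF aara_fconst]) (use assms(3) wf in auto)
qed

lemma eval_push:
  assumes "E x = Some v" "x \<noteq> ''h''"
    "eval (E(''h'' \<mapsto> fval n i, x \<mapsto> VCons (fval n i) v)) e r 0"
  shows "eval E (push n i x e) r 0"
  unfolding push_def
  by (rule eval_let0, rule eval_fconst, rule eval_let0, rule ev_Cons) (use assms in auto)

lemma aara_fold_onto:
  assumes "aara Ticks [''h'' \<mapsto> Base b, ''t'' \<mapsto> Base (AList [] b), ''a'' \<mapsto> Base c] 0 e (Base c) 0"
    and "nonneg b" "splits b b b" "y \<noteq> z"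
  shows "aara Ticks [y \<mapsto> Base (AList [] b), z \<mapsto> Base c] 0 (fold_onto y z e) (Base c) 0"
proof -
  have c: "nonneg c" using aara_wf[OF assms(1)] by simp
  have fold: "aara Ticks [''x'' \<mapsto> Base (AProd (AList [] b) c)] 0 (efold (EVar ''a'') e) (Base c) 0"
  proof (rule aara_efold)
    show "aara Ticks [''a'' \<mapsto> Base c] 0 (EVar ''a'') (Base c) 0" by (rule aara_Var) (use c in simp)
    show "splits (AList (shift []) b) (AList [] b) (AList [] b)"
      using assms by (auto intro: splits.intros)
  qed (use assms in simp_all)
  show ?thesis
    unfolding fold_onto_def
    by (rule aara_let0[where \<Theta> = Map.empty, OF aara_Pair fold]) (use assms c in \<open>auto intro!: wf_ctx_intros simp: map_le_def\<close>)
qed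

lemma eval_fold_onto:
  assumes e: "\<And>E h c. h \<in> A \<Longrightarrow> E ''h'' = Some (ea h) \<Longrightarrow> E ''a'' = Some (ec c) \<Longrightarrow>
       eval E e (ec (g h c)) 0"
    and "set xs \<subseteq> A" "E y = Some (vlist (map ea xs))" "E z = Some (ec c)"
  shows "eval E (fold_onto y z e) (ec (fold g xs c)) 0"
proof -
  have "eval (E(''x'' \<mapsto> VPair (vlist (map ea xs)) (ec c))) (efold (EVar ''a'') e)
      (ec (pfold (\<lambda>h t. g h) (\<lambda>c. c) xs c)) (0 + (\<Sum>i<length xs. 0))"
    by (rule eval_efold[where C = UNIV and A = A and ea = ea])
      (use assms in \<open>auto intro!: ev_Var\<close>)
  then show ?thesis
    unfolding fold_onto_def using assms
    by (auto intro!: eval_let0 ev_Pair simp: pfold_fold simp del: fun_upd_apply)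
qed

lemma splits_fty: "splits (fty n) (fty n) (fty n)"
  by (induction n) (auto intro: splits.intros)

lemma aara_cons_acc:
  assumes "nonneg b"
  shows "aara Ticks [''h'' \<mapsto> Base b, ''t'' \<mapsto> Base (AList [] b), ''a'' \<mapsto> Base (AList [] b)] 0
    (ECons ''h'' ''a'') (Base (AList [] b)) 0"
  by (rule aara_Weaken[OF aara_cons0])
    (use assms in \<open>auto intro!: wf_ctx_intros simp: map_le_def\<close>)

lemma eval_reverse_onto:
  assumes "E y = Some (vlist (map ea xs))" "E z = Some (vlist (map ea ys))"
  shows "eval E (fold_onto y z (ECons ''h'' ''a'')) (vlist (map ea (rev xs @ ys))) 0"
proof -
  have "eval E (fold_onto y z (ECons ''h'' ''a'')) (vlist (map ea (fold (#) xs ys))) 0"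
    by (rule eval_fold_onto[where A = UNIV and ea = ea and ec = "\<lambda>c. vlist (map ea c)"])
      (use assms in \<open>auto intro: ev_Cons\<close>)
  then show ?thesis by (simp add: fold_Cons_rev)
qed

text \<open>Bits are the values of \<open>fty 1\<close>, so the list programs for finite types apply
  to the input directly.\<close>

lemma enc_bits_vlist: "enc_bits w = vlist (map (\<lambda>b. fval 1 (of_bool b)) w)"
  by (induction w) (auto simp: enc_bit_def)

locale compiler =
  fixes M :: "('q, 'a) tm"
  assumes M: "turing_machine M"
begin

abbreviation "nQ \<equiv> card (states M)"
abbreviation "nA \<equiv> card (tape_alphabet M)"
abbreviation "qcode \<equiv> code (states M)"
abbreviation "acode \<equiv> code (tape_alphabet M)"
abbreviation "enc_sym a \<equiv> fval nA (acode a)"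

section \<open>The compiled program and its pieces\<close>

definition config_ty :: abase where
  "config_ty = AProd (fty nQ) (AProd (tape_ty nA) (tape_ty nA))"

definition enc_zipper :: "('q, 'a) zipper \<Rightarrow> val" where
  "enc_zipper = (\<lambda>(q, ls, rs). VPair (fval nQ (qcode q))
     (VPair (vlist (map enc_sym ls)) (vlist (map enc_sym rs))))"

definition zip_exp :: "'q \<Rightarrow> exp" where
  "zip_exp q = ELet ''s'' (fconst nQ (qcode q)) (ELet ''x'' (EPair ''l'' ''r'') (EPair ''s'' ''x''))"

text \<open>The scanned cell has already been taken off \<open>r\<close>, so even a final state has
  to put its symbol back. On a left move the written symbol goes onto \<open>r\<close> first and the
  neighbour from \<open>l\<close> on top of it, as the new scanned cell.\<close>

definition act :: "'q \<Rightarrow> 'a \<Rightarrow> exp" where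
  "act q a = (if q = final M then push nA (acode a) ''r'' (zip_exp q) else case delta M q a of
     (q', a', MoveR) \<Rightarrow> push nA (acode a') ''l'' (zip_exp q')
   | (q', a', MoveL) \<Rightarrow> push nA (acode a') ''r''
       (ECaseList ''l'' (ELet ''l'' ENil (zip_exp q')) ''h'' ''l''
         (ELet ''r'' (ECons ''h'' ''r'') (zip_exp q'))))"

text \<open>Codes are decoded while the expression is built, so each branch is a fixed
  \<open>act\<close>. Numbers that are no codes also give typable branches.\<close>

definition table :: exp where
  "table = fcase nQ ''s'' (\<lambda>i. fcase nA ''h'' (\<lambda>j.
     act (inv_into (states M) qcode i) (inv_into (tape_alphabet M) acode j)))"

definition step_exp :: exp where
  "step_exp = ECasePair ''a'' ''s'' ''x'' (ECasePair ''x'' ''l'' ''r''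
     (ECaseList ''r''
       (ELet ''h'' (fconst nA (acode (blank M))) (ELet ''r'' ENil table)) ''h'' ''r'' table))"

text \<open>A fold produces the tape back to front, hence the second reversal. The head starts on
  cell 1, with just the end marker on its left.\<close>

definition init_exp :: exp where
  "init_exp = ELet ''n'' ENil (ELet ''r'' (fold_onto ''x'' ''n''
       (fcase 1 ''h'' (\<lambda>i. push nA (acode (bit_sym M (i \<noteq> 0))) ''a'' (EVar ''a''))))
     (ELet ''n'' ENil (ELet ''r'' (fold_onto ''r'' ''n'' (ECons ''h'' ''a''))
     (ELet ''l'' ENil (push nA (acode (left_end M)) ''l'' (zip_exp (start M)))))))"

text \<open>Under \<open>outputs_bits\<close>, other symbols in cells from 1 on occur only beyond
  the first blank of the final tape. Whatever is collected there is discarded at that blank, so they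
  may leave the accumulator alone.\<close>

definition read_exp :: "'a \<Rightarrow> exp" where
  "read_exp a = (if a = blank M then ENil else if a \<in> range (bit_sym M)
     then push 1 (of_bool (inv (bit_sym M) a)) ''a'' (EVar ''a'') else EVar ''a'')"

text \<open>A blank resets the accumulator when the tape is read from its far end. Cell 0 has to be dropped
  first, since \<open>left_end M = blank M\<close> is possible.\<close>

definition output_exp :: exp where
  "output_exp = ECasePair ''a'' ''s'' ''x'' (ECasePair ''x'' ''l'' ''r''
     (ELet ''l'' (fold_onto ''l'' ''r'' (ECons ''h'' ''a'')) (ECaseList ''l'' ENil ''h'' ''l''
       (ELet ''n'' ENil (ELet ''l'' (fold_onto ''l'' ''n'' (ECons ''h'' ''a'')) (ELet ''n'' ENil
         (fold_onto ''l'' ''n''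
           (fcase nA ''h'' (\<lambda>j. read_exp (inv_into (tape_alphabet M) acode j))))))))))"

text \<open>The input serves twice: \<open>y\<close> is the loop counter and holds all the
  potential, while \<open>x\<close> only supplies the symbols of the initial tape.\<close>

definition program :: "nat \<Rightarrow> nat \<Rightarrow> exp" where
  "program N k = EFun ''f'' ''x'' (EShare ''x'' ''y'' ''x'' (ELet ''a'' init_exp
     (ELet ''x'' (EPair ''y'' ''a'') (ELet ''a'' (iter_exp N step_exp k) output_exp))))"

section \<open>Annotated typing of the compiled program\<close>

lemma nonneg_config_ty [simp]: "nonneg config_ty"
  by (simp add: config_ty_def)

abbreviation "lr_ctx \<equiv> [''l'' \<mapsto> Base (tape_ty nA), ''r'' \<mapsto> Base (tape_ty nA)]"

lemma aara_zip_exp: "aara Ticks lr_ctx 0 (zip_exp q) (Base config_ty) 0"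
proof -
  have pair: "aara Ticks [''s'' \<mapsto> Base (fty nQ), ''x'' \<mapsto> Base (AProd (tape_ty nA) (tape_ty nA))] 0
      (EPair ''s'' ''x'') (Base config_ty) 0"
    unfolding config_ty_def by (rule aara_Pair) auto
  have let_pair: "aara Ticks (lr_ctx(''s'' \<mapsto> Base (fty nQ))) 0
      (ELet ''x'' (EPair ''l'' ''r'') (EPair ''s'' ''x'')) (Base config_ty) 0"
    by (intro aara_let0[OF aara_Pair pair]) (auto intro!: wf_ctx_intros simp: map_le_def)
  show ?thesis
    unfolding zip_exp_def
    by (rule aara_let0[OF aara_fconst let_pair]) (auto intro!: wf_ctx_intros simp: map_le_def)
qed

lemma aara_act: "aara Ticks lr_ctx 0 (act q a) (Base config_ty) 0"
proof -
  have nil: "aara Ticks [''r'' \<mapsto> Base (tape_ty nA)] 0 (ELet ''l'' ENil (zip_exp q'))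
      (Base config_ty) 0" for q'
  proof (rule aara_let0[OF aara_Nil])
    show "aara Ticks ([''r'' \<mapsto> Base (tape_ty nA)](''l'' \<mapsto> Base (tape_ty nA))) 0 (zip_exp q')
        (Base config_ty) 0"
      using aara_zip_exp[of q'] by (subst fun_upd_twist) auto
  qed (auto intro!: wf_ctx_intros)
  have cons: "aara Ticks [''r'' \<mapsto> Base (tape_ty nA), ''h'' \<mapsto> Base (fty nA), ''l'' \<mapsto> Base (tape_ty nA)] 0
      (ELet ''r'' (ECons ''h'' ''r'') (zip_exp q')) (Base config_ty) 0" for q'
    by (rule aara_let0[OF aara_cons0 aara_zip_exp]) (auto intro!: wf_ctx_intros simp: map_le_def)
  have move: "aara Ticks lr_ctx 0 (ECaseList ''l'' (ELet ''l'' ENil (zip_exp q')) ''h'' ''l''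
         (ELet ''r'' (ECons ''h'' ''r'') (zip_exp q'))) (Base config_ty) 0" for q'
    by (rule aara_caselist0[OF nil cons]) (auto intro!: wf_ctx_intros simp: map_le_def)
  show ?thesis
    by (auto simp: act_def intro!: aara_push move aara_zip_exp split: prod.splits dir.splits)
qed

lemma aara_table:
  "aara Ticks (lr_ctx(''h'' \<mapsto> Base (fty nA), ''s'' \<mapsto> Base (fty nQ))) 0 table (Base config_ty) 0"
  unfolding table_def
  by (rule aara_fcase_upd, rule aara_fcase_upd, rule aara_act) auto

lemma aara_step_exp: "aara Ticks [''a'' \<mapsto> Base config_ty] 0 step_exp (Base config_ty) 0"
proof -
  have nil': "aara Ticks [''l'' \<mapsto> Base (tape_ty nA), ''s'' \<mapsto> Base (fty nQ), ''h'' \<mapsto> Base (fty nA)] 0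
      (ELet ''r'' ENil table) (Base config_ty) 0"
  proof (rule aara_let0[OF aara_Nil])
    show "aara Ticks ([''l'' \<mapsto> Base (tape_ty nA), ''s'' \<mapsto> Base (fty nQ), ''h'' \<mapsto> Base (fty nA)]
        (''r'' \<mapsto> Base (tape_ty nA))) 0 table (Base config_ty) 0"
      by (rule aara_Weaken[OF aara_table]) (auto intro!: wf_ctx_intros simp: map_le_def)
  qed (auto intro!: wf_ctx_intros simp: map_le_def)
  have nil: "aara Ticks [''l'' \<mapsto> Base (tape_ty nA), ''s'' \<mapsto> Base (fty nQ)] 0
      (ELet ''h'' (fconst nA (acode (blank M))) (ELet ''r'' ENil table)) (Base config_ty) 0"
    by (rule aara_let0[OF aara_fconst nil']) (auto intro!: wf_ctx_intros)
  have cons: "aara Ticks [''l'' \<mapsto> Base (tape_ty nA), ''s'' \<mapsto> Base (fty nQ), ''h'' \<mapsto> Base (fty nA),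
      ''r'' \<mapsto> Base (tape_ty nA)] 0 table (Base config_ty) 0"
    by (rule aara_Weaken[OF aara_table]) (auto intro!: wf_ctx_intros simp: map_le_def)
  have split: "aara Ticks [''s'' \<mapsto> Base (fty nQ), ''l'' \<mapsto> Base (tape_ty nA), ''r'' \<mapsto> Base (tape_ty nA)] 0
      (ECaseList ''r'' (ELet ''h'' (fconst nA (acode (blank M))) (ELet ''r'' ENil table))
         ''h'' ''r'' table) (Base config_ty) 0"
    by (rule aara_caselist0[OF nil cons]) (auto intro!: wf_ctx_intros simp: map_le_def)
  have pair: "aara Ticks [''s'' \<mapsto> Base (fty nQ), ''x'' \<mapsto> Base (AProd (tape_ty nA) (tape_ty nA))] 0
      (ECasePair ''x'' ''l'' ''r''
        (ECaseList ''r'' (ELet ''h'' (fconst nA (acode (blank M))) (ELet ''r'' ENil table))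
         ''h'' ''r'' table)) (Base config_ty) 0"
    by (rule aara_casepair[OF split]) (auto intro!: wf_ctx_intros simp: map_le_def)
  show ?thesis
    unfolding step_exp_def
    by (rule aara_casepair[where \<Gamma> = Map.empty, OF pair])
      (auto intro!: wf_ctx_intros simp: config_ty_def)
qed

lemma aara_init_exp: "aara Ticks [''x'' \<mapsto> Base (AList [] (fty 1))] 0 init_exp (Base config_ty) 0"
proof -
  have read: "aara Ticks [''h'' \<mapsto> Base (fty 1), ''t'' \<mapsto> Base (AList [] (fty 1)),
       ''a'' \<mapsto> Base (tape_ty nA)] 0
     (fcase 1 ''h'' (\<lambda>i. push nA (acode (bit_sym M (i \<noteq> 0))) ''a'' (EVar ''a'')))
     (Base (tape_ty nA)) 0"
    by (rule aara_fcase[where \<Gamma> = "[''a'' \<mapsto> Base (tape_ty nA)]"], rule aara_push, rule aara_Var)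
      (auto intro!: wf_ctx_intros simp: map_le_def)
  have l: "aara Ticks [''r'' \<mapsto> Base (tape_ty nA)] 0
      (ELet ''l'' ENil (push nA (acode (left_end M)) ''l'' (zip_exp (start M)))) (Base config_ty) 0"
  proof (rule aara_let0[OF aara_Nil])
    show "aara Ticks ([''r'' \<mapsto> Base (tape_ty nA)](''l'' \<mapsto> Base (tape_ty nA))) 0
        (push nA (acode (left_end M)) ''l'' (zip_exp (start M))) (Base config_ty) 0"
      using aara_zip_exp[of "start M"] by (subst fun_upd_twist) (auto intro!: aara_push)
  qed (auto intro!: wf_ctx_intros)
  have rev': "aara Ticks [''r'' \<mapsto> Base (tape_ty nA), ''n'' \<mapsto> Base (tape_ty nA)] 0
      (ELet ''r'' (fold_onto ''r'' ''n'' (ECons ''h'' ''a''))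
        (ELet ''l'' ENil (push nA (acode (left_end M)) ''l'' (zip_exp (start M)))))
      (Base config_ty) 0"
    by (rule aara_let0[OF aara_fold_onto[OF aara_cons_acc] l])
      (auto intro!: wf_ctx_intros splits_fty splits.intros simp: map_le_def)
  have rev: "aara Ticks [''r'' \<mapsto> Base (tape_ty nA)] 0
      (ELet ''n'' ENil (ELet ''r'' (fold_onto ''r'' ''n'' (ECons ''h'' ''a''))
        (ELet ''l'' ENil (push nA (acode (left_end M)) ''l'' (zip_exp (start M))))))
      (Base config_ty) 0"
    by (rule aara_let0[OF aara_Nil rev']) (auto intro!: wf_ctx_intros)
  have body: "aara Ticks [''x'' \<mapsto> Base (AList [] (fty 1)), ''n'' \<mapsto> Base (tape_ty nA)] 0
    (ELet ''r'' (fold_onto ''x'' ''n''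
       (fcase 1 ''h'' (\<lambda>i. push nA (acode (bit_sym M (i \<noteq> 0))) ''a'' (EVar ''a''))))
     (ELet ''n'' ENil (ELet ''r'' (fold_onto ''r'' ''n'' (ECons ''h'' ''a''))
     (ELet ''l'' ENil (push nA (acode (left_end M)) ''l'' (zip_exp (start M)))))))
    (Base config_ty) 0"
    by (rule aara_let0[where \<Theta> = Map.empty, OF aara_fold_onto[OF read] rev])
      (auto intro!: wf_ctx_intros splits_fty splits.intros simp: map_le_def)
  show ?thesis
    unfolding init_exp_def by (rule aara_let0[OF aara_Nil body]) (auto intro!: wf_ctx_intros)
qed

lemma aara_output_exp: "aara Ticks [''a'' \<mapsto> Base config_ty] 0 output_exp (Base (AList [] (fty 1))) 0"
proof -
  let ?bits = "Base (AList [] (fty 1))"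
  have "aara Ticks [''a'' \<mapsto> ?bits] 0 (read_exp a) ?bits 0" for a
    unfolding read_exp_def
    by (auto intro!: aara_push aara_Var aara_Nil[THEN aara_Weaken] wf_ctx_intros
        simp del: fun_upd_apply simp: fun_upd_same fun_upd_other)
  then have read: "aara Ticks [''h'' \<mapsto> Base (fty nA), ''t'' \<mapsto> Base (tape_ty nA), ''a'' \<mapsto> ?bits] 0
     (fcase nA ''h'' (\<lambda>j. read_exp (inv_into (tape_alphabet M) acode j))) ?bits 0"
    by (rule aara_fcase) (auto intro!: wf_ctx_intros simp: map_le_def)
  let ?fold = "fold_onto ''l'' ''n''
       (fcase nA ''h'' (\<lambda>j. read_exp (inv_into (tape_alphabet M) acode j)))"
  let ?tape = "Base (tape_ty nA)"
  have read: "aara Ticks [''l'' \<mapsto> ?tape] 0 (ELet ''n'' ENil ?fold) ?bits 0"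
    by (rule aara_let0[OF aara_Nil aara_fold_onto[OF read]])
      (auto intro!: wf_ctx_intros splits_fty)
  have rev: "aara Ticks [''l'' \<mapsto> ?tape, ''n'' \<mapsto> ?tape] 0
     (ELet ''l'' (fold_onto ''l'' ''n'' (ECons ''h'' ''a'')) (ELet ''n'' ENil ?fold)) ?bits 0"
    by (rule aara_let0[where \<Theta> = Map.empty, OF aara_fold_onto[OF aara_cons_acc] read])
      (auto intro!: wf_ctx_intros splits_fty simp: map_le_def)
  have cons: "aara Ticks [''h'' \<mapsto> Base (fty nA), ''l'' \<mapsto> ?tape] 0
     (ELet ''n'' ENil (ELet ''l'' (fold_onto ''l'' ''n'' (ECons ''h'' ''a'')) (ELet ''n'' ENil ?fold)))
     ?bits 0"
    by (rule aara_let0[OF aara_Nil rev]) (auto intro!: wf_ctx_intros simp: map_le_def)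
  have nil: "aara Ticks Map.empty 0 ENil ?bits 0"
    by (rule aara_Nil) simp
  let ?tl = "ECaseList ''l'' ENil ''h'' ''l'' (ELet ''n'' ENil
     (ELet ''l'' (fold_onto ''l'' ''n'' (ECons ''h'' ''a'')) (ELet ''n'' ENil ?fold)))"
  have tl: "aara Ticks [''l'' \<mapsto> ?tape] 0 ?tl ?bits 0"
    by (rule aara_caselist0[OF nil cons]) (auto intro!: wf_ctx_intros)
  have rewind: "aara Ticks lr_ctx 0 (ELet ''l'' (fold_onto ''l'' ''r'' (ECons ''h'' ''a'')) ?tl) ?bits 0"
    by (rule aara_let0[where \<Theta> = Map.empty, OF aara_fold_onto[OF aara_cons_acc] tl])
      (auto intro!: wf_ctx_intros splits_fty simp: map_le_def)
  have pair: "aara Ticks [''s'' \<mapsto> Base (fty nQ), ''x'' \<mapsto> Base (AProd (tape_ty nA) (tape_ty nA))] 0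
     (ECasePair ''x'' ''l'' ''r'' (ELet ''l'' (fold_onto ''l'' ''r'' (ECons ''h'' ''a'')) ?tl)) ?bits 0"
    by (rule aara_casepair[OF rewind]) (auto intro!: wf_ctx_intros simp: map_le_def)
  show ?thesis
    unfolding output_exp_def
    by (rule aara_casepair[where \<Gamma> = Map.empty, OF pair])
      (auto intro!: wf_ctx_intros simp: config_ty_def)
qed

lemma aara_program:
  "aara Ticks Map.empty 0 (program N k)
    (Funs {Arrow (AList (replicate k (of_nat N)) (fty 1), of_nat N) (AList [] (fty 1), 0)}) 0"
proof -
  let ?in = "AList (replicate k (of_nat N)) (fty 1)" and ?bits = "AList [] (fty 1)"
  let ?A = "Arrow (?in, of_nat N) (?bits, 0)"
  have A: "wf_arrows {?A}" by (auto simp: wf_arrows_def)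
  have iter: "aara Ticks [''x'' \<mapsto> Base (AProd ?in config_ty)] (of_nat N)
      (ELet ''a'' (iter_exp N step_exp k) output_exp) (Base ?bits) 0"
    by (rule aara_let[where \<Theta> = Map.empty,
          OF aara_iter[OF aara_step_exp nonneg_fty[of 1] splits_fty[of 1]] aara_output_exp])
      (auto intro!: wf_ctx_intros)
  have pair: "aara Ticks [''y'' \<mapsto> Base ?in, ''a'' \<mapsto> Base config_ty] (of_nat N)
      (ELet ''x'' (EPair ''y'' ''a'') (ELet ''a'' (iter_exp N step_exp k) output_exp))
      (Base ?bits) 0"
    by (rule aara_let0[where \<Theta> = Map.empty, OF aara_Pair iter]) (auto intro!: wf_ctx_intros)
  have init: "aara Ticks [''y'' \<mapsto> Base ?in, ''x'' \<mapsto> Base ?bits] (of_nat N)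
      (ELet ''a'' init_exp
        (ELet ''x'' (EPair ''y'' ''a'') (ELet ''a'' (iter_exp N step_exp k) output_exp)))
      (Base ?bits) 0"
    by (rule aara_let0[OF aara_init_exp pair]) (auto intro!: wf_ctx_intros simp: map_le_def)
  \<comment> \<open>All potential stays with the counter; the empty annotation of the other copy
    counts as a zero vector.\<close>
  have sp: "splits_aty (Base ?in) (Base ?in) (Base ?bits)"
    using splits_fty[of 1] by (auto intro!: splits_aty.intros splits.intros)
  have share: "aara Ticks [''x'' \<mapsto> Base ?in] (of_nat N)
      (EShare ''x'' ''y'' ''x'' (ELet ''a'' init_exp
        (ELet ''x'' (EPair ''y'' ''a'') (ELet ''a'' (iter_exp N step_exp k) output_exp))))
      (Base ?bits) 0"
    by (rule aara_Share[where \<Gamma> = Map.empty, OF _ _ _ _ _ sp init]) auto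
  then have "aara Ticks [''f'' \<mapsto> Funs {?A}, ''x'' \<mapsto> Base ?in] (of_nat N)
      (EShare ''x'' ''y'' ''x'' (ELet ''a'' init_exp
        (ELet ''x'' (EPair ''y'' ''a'') (ELet ''a'' (iter_exp N step_exp k) output_exp))))
      (Base ?bits) 0"
    by (rule aara_Weaken) (use A in \<open>auto intro!: wf_ctx_intros simp: map_le_def\<close>)
  then show ?thesis
    unfolding program_def
    by (intro aara_Fun A) (auto simp: zero_ctx_def simp del: fun_upd_apply intro!: exI[of _ "{}"])
qed

section \<open>Evaluation of the compiled program\<close>

lemma eval_zip_exp:
  assumes "E ''l'' = Some v" "E ''r'' = Some v'"
  shows "eval E (zip_exp q) (VPair (fval nQ (qcode q)) (VPair v v')) 0"
  unfolding zip_exp_def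
  by (rule eval_let0, rule eval_fconst, rule eval_let0, rule ev_Pair, rule_tac [3] ev_Pair)
    (use assms in auto)

lemma eval_act:
  assumes l: "E ''l'' = Some (vlist (map enc_sym ls))" and r: "E ''r'' = Some (vlist (map enc_sym rs))"
  shows "eval E (act q a) (enc_zipper (zstep M (q, ls, a # rs))) 0"
proof (cases "q = final M")
  case True
  have "eval E (push nA (acode a) ''r'' (zip_exp q)) (enc_zipper (q, ls, a # rs)) 0"
    unfolding enc_zipper_def prod.case
    by (rule eval_push, rule r, simp, rule eval_zip_exp) (use l in auto)
  then show ?thesis using True by (simp add: act_def zstep_def)
next
  case False
  obtain q' a' d where d: "delta M q a = (q', a', d)" by (cases "delta M q a")
  show ?thesis
  proof (cases d)
    case MoveR
    have "eval E (push nA (acode a') ''l'' (zip_exp q')) (enc_zipper (q', a' # ls, rs)) 0"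
      unfolding enc_zipper_def prod.case
      by (rule eval_push, rule l, simp, rule eval_zip_exp) (use r in auto)
    then show ?thesis using False MoveR d by (simp add: act_def zstep_def)
  next
    case MoveL
    let ?move = "ECaseList ''l'' (ELet ''l'' ENil (zip_exp q')) ''h'' ''l''
         (ELet ''r'' (ECons ''h'' ''r'') (zip_exp q'))"
    let ?E = "E(''h'' \<mapsto> enc_sym a', ''r'' \<mapsto> VCons (enc_sym a') (vlist (map enc_sym rs)))"
    have "eval ?E ?move (enc_zipper (zstep M (q, ls, a # rs))) 0"
    proof (cases ls)
      case Nil
      have "eval ?E ?move (enc_zipper (q', [], a' # rs)) 0"
        unfolding enc_zipper_def prod.case
        by (rule ev_CaseNil, simp add: l Nil, rule eval_let0, rule ev_Nil, rule eval_zip_exp) auto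
      then show ?thesis using Nil False MoveL d by (simp add: zstep_def)
    next
      case (Cons b bs)
      have "eval ?E ?move (enc_zipper (q', bs, b # a' # rs)) 0"
        unfolding enc_zipper_def prod.case
        by (rule ev_CaseCons, simp add: l Cons, rule eval_let0, rule ev_Cons, simp, simp, rule eval_zip_exp) auto
      then show ?thesis using Cons False MoveL d by (simp add: zstep_def)
    qed
    then have "eval E (push nA (acode a') ''r'' ?move) (enc_zipper (zstep M (q, ls, a # rs))) 0"
      using r by (intro eval_push[where x = "''r''"]) auto
    then show ?thesis using False MoveL d by (simp add: act_def)
  qed
qed

lemma eval_table:
  assumes "q \<in> states M" "a \<in> tape_alphabet M"
    and "E ''s'' = Some (fval nQ (qcode q))" "E ''h'' = Some (enc_sym a)"
    and "E ''l'' = Some (vlist (map enc_sym ls))" "E ''r'' = Some (vlist (map enc_sym rs))"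
  shows "eval E table (enc_zipper (zstep M (q, ls, a # rs))) 0"
proof -
  note fin = turing_machineD(1,2)[OF M]
  show ?thesis
    unfolding table_def
    by (rule eval_fcase, rule assms(3), rule code(1)[OF fin(1) assms(1)],
        rule eval_fcase, simp add: assms(4), rule code(1)[OF fin(2) assms(2)],
        subst code(2)[OF fin(1) assms(1)], subst code(2)[OF fin(2) assms(2)], rule eval_act)
      (use assms in auto)
qed

lemma eval_step_exp:
  assumes "z \<in> zippers M" "E ''a'' = Some (enc_zipper z)"
  shows "eval E step_exp (enc_zipper (zstep M z)) 0"
proof -
  obtain q ls rs where z: "z = (q, ls, rs)" by (cases z)
  have q: "q \<in> states M" and rs: "set rs \<subseteq> tape_alphabet M"
    using assms by (auto simp: z zippers_def)
  let ?E = "E(''s'' \<mapsto> fval nQ (qcode q),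
    ''x'' \<mapsto> VPair (vlist (map enc_sym ls)) (vlist (map enc_sym rs)),
    ''l'' \<mapsto> vlist (map enc_sym ls), ''r'' \<mapsto> vlist (map enc_sym rs))"
  have "eval ?E (ECaseList ''r''
       (ELet ''h'' (fconst nA (acode (blank M))) (ELet ''r'' ENil table)) ''h'' ''r'' table)
     (enc_zipper (zstep M z)) 0"
  proof (cases rs)
    case Nil
    have "eval (?E(''h'' \<mapsto> enc_sym (blank M), ''r'' \<mapsto> VNil)) table
        (enc_zipper (zstep M (q, ls, [blank M]))) 0"
      by (rule eval_table) (use q turing_machineD(5)[OF M] in auto)
    \<comment> \<open>Reading past the end of \<open>rs\<close> yields a blank, so supplying that
      blank explicitly gives the same step.\<close>
    moreover have "zstep M (q, ls, [blank M]) = zstep M z"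
      by (simp add: z Nil zstep_def)
    ultimately show ?thesis
      by (intro ev_CaseNil eval_let0[OF eval_fconst] eval_let0[OF ev_Nil]) (auto simp: Nil)
  next
    case (Cons a rs')
    have "eval (?E(''h'' \<mapsto> enc_sym a, ''r'' \<mapsto> vlist (map enc_sym rs'))) table
        (enc_zipper (zstep M (q, ls, a # rs'))) 0"
      by (rule eval_table) (use q rs in \<open>auto simp: Cons\<close>)
    then show ?thesis
      by (intro ev_CaseCons[where x = "''r''"]) (auto simp: Cons z)
  qed
  then show ?thesis
    unfolding step_exp_def
    by (intro ev_CasePair[where x = "''a''"] ev_CasePair[where x = "''x''"])
      (auto simp: assms(2) z enc_zipper_def)
qed

lemma eval_init_exp:
  assumes "E ''x'' = Some (enc_bits w)"
  shows "eval E init_exp (enc_zipper (start M, [left_end M], map (bit_sym M) w)) 0"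
proof -
  let ?tape = "\<lambda>c. vlist (map enc_sym c)"
  have read: "eval E' (fold_onto ''x'' ''n''
       (fcase 1 ''h'' (\<lambda>i. push nA (acode (bit_sym M (i \<noteq> 0))) ''a'' (EVar ''a''))))
     (?tape (rev (map (bit_sym M) w))) 0"
    if "E' ''x'' = Some (enc_bits w)" "E' ''n'' = Some VNil" for E'
  proof -
    have "eval E' (fold_onto ''x'' ''n''
       (fcase 1 ''h'' (\<lambda>i. push nA (acode (bit_sym M (i \<noteq> 0))) ''a'' (EVar ''a''))))
     (?tape (fold (\<lambda>b c. bit_sym M b # c) w [])) 0"
    proof (rule eval_fold_onto[where A = UNIV and ea = "\<lambda>b. fval 1 (of_bool b)" and ec = ?tape])
      fix E :: "var \<rightharpoonup> val" and b :: bool and c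
      assume *: "E ''h'' = Some (fval 1 (of_bool b))" "E ''a'' = Some (?tape c)"
      show "eval E (fcase 1 ''h'' (\<lambda>i. push nA (acode (bit_sym M (i \<noteq> 0))) ''a'' (EVar ''a'')))
          (?tape (bit_sym M b # c)) 0"
        by (rule eval_fcase, rule *(1), simp, rule eval_push, simp add: *(2), simp, rule ev_Var) simp
    qed (use that in \<open>auto simp: enc_bits_vlist\<close>)
    moreover have "fold (\<lambda>b c. bit_sym M b # c) w c = rev (map (bit_sym M) w) @ c" for c
      by (induction w arbitrary: c) auto
    ultimately show ?thesis by simp
  qed
  have rev: "eval E' (fold_onto ''r'' ''n'' (ECons ''h'' ''a'')) (?tape (map (bit_sym M) w)) 0"
    if "E' ''r'' = Some (?tape (rev (map (bit_sym M) w)))" "E' ''n'' = Some VNil" for E'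
    using eval_reverse_onto[of E' "''r''" enc_sym "rev (map (bit_sym M) w)" "''n''" "[]"] that
    by simp
  show ?thesis
    unfolding init_exp_def enc_zipper_def prod.case
    by (rule eval_let0, rule ev_Nil, rule eval_let0, rule read, simp add: assms, simp,
        rule eval_let0, rule ev_Nil, rule eval_let0, rule rev, simp, simp,
        rule eval_let0, rule ev_Nil, rule eval_push, simp, simp, rule eval_zip_exp) auto
qed

definition read :: "'a \<Rightarrow> bool list \<Rightarrow> bool list" where
  "read a acc = (if a = blank M then [] else if a \<in> range (bit_sym M)
     then inv (bit_sym M) a # acc else acc)"

lemma eval_read_exp:
  assumes "E ''a'' = Some (enc_bits c)"
  shows "eval E (read_exp a) (enc_bits (read a c)) 0"
proof -
  have "eval E (push 1 (of_bool b) ''a'' (EVar ''a'')) (enc_bits (b # c)) 0" for b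
    by (rule eval_push, rule assms, simp, rule ev_Var) (simp add: enc_bit_def)
  then show ?thesis
    using assms by (auto simp: read_exp_def read_def intro: ev_Nil ev_Var)
qed

lemma eval_output_exp:
  assumes z: "(q, ls, rs) \<in> zippers M" and E: "E ''a'' = Some (enc_zipper (q, ls, rs))"
  shows "eval E output_exp (enc_bits (foldr read (tl (rev ls @ rs)) [])) 0"
proof -
  let ?tape = "\<lambda>c. vlist (map enc_sym c)"
  let ?read = "fcase nA ''h'' (\<lambda>j. read_exp (inv_into (tape_alphabet M) acode j))"
  have read: "eval E' (fold_onto ''l'' ''n'' ?read) (enc_bits (foldr read xs [])) 0"
    if E': "E' ''l'' = Some (?tape (rev xs))" "E' ''n'' = Some VNil" and xs: "set xs \<subseteq> tape_alphabet M"
    for E' xs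
    unfolding foldr_conv_fold
  proof (rule eval_fold_onto[where A = "tape_alphabet M" and ea = enc_sym and ec = enc_bits])
    fix E :: "var \<rightharpoonup> val" and a c
    assume *: "a \<in> tape_alphabet M" "E ''h'' = Some (enc_sym a)" "E ''a'' = Some (enc_bits c)"
    note a = turing_machineD(2)[OF M] *(1)
    show "eval E ?read (enc_bits (read a c)) 0"
      by (rule eval_fcase, rule *(2), rule code(1)[OF a], subst code(2)[OF a], rule eval_read_exp)
        (use * in auto)
  qed (use xs E' in auto)
  have rev: "eval E' (fold_onto ''l'' ''n'' (ECons ''h'' ''a'')) (?tape (rev xs)) 0"
    if "E' ''l'' = Some (?tape xs)" "E' ''n'' = Some VNil" for E' xs
    using eval_reverse_onto[of E' "''l''" enc_sym xs "''n''" "[]"] that by simp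
  have tl: "eval E' (ECaseList ''l'' ENil ''h'' ''l''
       (ELet ''n'' ENil (ELet ''l'' (fold_onto ''l'' ''n'' (ECons ''h'' ''a'')) (ELet ''n'' ENil
         (fold_onto ''l'' ''n'' ?read))))) (enc_bits (foldr read (tl xs) [])) 0"
    if E': "E' ''l'' = Some (?tape xs)" and xs: "set xs \<subseteq> tape_alphabet M" for E' xs
  proof (cases xs)
    case Nil
    with E' show ?thesis by (auto intro!: ev_CaseNil ev_Nil)
  next
    case (Cons a as)
    show ?thesis
      by (rule ev_CaseCons, simp add: E' Cons, rule eval_let0, rule ev_Nil,
          rule eval_let0, rule rev[of _ as], simp, simp, rule eval_let0, rule ev_Nil, rule read)
        (use xs in \<open>auto simp: Cons\<close>)
  qed
  show ?thesis
    unfolding output_exp_def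
    by (rule ev_CasePair, simp add: E enc_zipper_def, rule ev_CasePair, simp,
        rule eval_let0, rule eval_reverse_onto[where xs = ls and ys = rs and ea = enc_sym], simp, simp,
        rule tl) (use z in \<open>auto simp: zippers_def\<close>)
qed

section \<open>Runs of the whole program and the output they read off\<close>

abbreviation "start_zipper w \<equiv> (start M, [left_end M], map (bit_sym M) w)"

lemma zsteps_closed: "(zstep M ^^ n) (start_zipper w) \<in> zippers M"
proof (induction n)
  case 0
  show ?case using turing_machineD[OF M] by (auto simp: zippers_def)
next
  case (Suc n)
  then show ?case by (simp add: zstep_closed[OF M])
qed

text \<open>Only \<open>iter_exp\<close> executes ticks, so its cost is the cost of the whole
  run.\<close>

lemma eval_program:
  assumes "(zstep M ^^ (N * iters k (length w))) (start_zipper w) = (q, ls, rs)"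
  shows "eval_on (program N k) (enc_bits w) (enc_bits (foldr read (tl (rev ls @ rs)) []))
    (of_nat (N * iters k (length w)))"
proof -
  define n where "n = N * iters k (length w)"
  note z0 = zsteps_closed[of 0 w, simplified]
  have iter: "eval E' (ELet ''a'' (iter_exp N step_exp k) output_exp)
      (enc_bits (foldr read (tl (rev ls @ rs)) [])) (of_nat n)"
    if "E' ''x'' = Some (VPair (enc_bits w) (enc_zipper (start_zipper w)))" for E'
  proof -
    have "eval E' (iter_exp N step_exp k) (enc_zipper (q, ls, rs)) (of_nat n)"
      unfolding assms[symmetric] n_def
      by (rule eval_iter[where C = "zippers M" and ea = "\<lambda>b. fval 1 (of_bool b)"])
        (use that z0 in \<open>auto simp: eval_step_exp zstep_closed[OF M] enc_bits_vlist\<close>)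
    moreover have "eval (E'(''a'' \<mapsto> enc_zipper (q, ls, rs))) output_exp
        (enc_bits (foldr read (tl (rev ls @ rs)) [])) 0"
      by (rule eval_output_exp) (use zsteps_closed[of n w] assms in \<open>auto simp: n_def\<close>)
    ultimately show ?thesis using ev_Let by fastforce
  qed
  let ?body = "EShare ''x'' ''y'' ''x'' (ELet ''a'' init_exp
     (ELet ''x'' (EPair ''y'' ''a'') (ELet ''a'' (iter_exp N step_exp k) output_exp)))"
  have body: "eval E' ?body (enc_bits (foldr read (tl (rev ls @ rs)) [])) (of_nat n)"
    if "E' ''x'' = Some (enc_bits w)" for E'
    by (rule ev_Share, rule that, rule eval_let0, rule eval_init_exp, simp, rule eval_let0, rule ev_Pair,
        simp, simp, rule iter) simp
  have "eval Map.empty (program N k) (VClosure Map.empty ''f'' ''x'' ?body) 0"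
    unfolding program_def by (rule ev_Fun)
  moreover have "eval ([''f'' \<mapsto> VClosure Map.empty ''f'' ''x'' ?body, ''x'' \<mapsto> enc_bits w]) ?body
      (enc_bits (foldr read (tl (rev ls @ rs)) [])) (of_nat n)"
    by (rule body) simp
  ultimately show ?thesis
    unfolding eval_on_def n_def by force
qed

text \<open>A blank at the front gives the empty list whatever follows, so bits are demanded only
  before the first blank.\<close>

lemma foldr_read:
  assumes "\<And>a. a \<in> set (takeWhile (\<lambda>a. a \<noteq> blank M) as) \<Longrightarrow> a \<in> range (bit_sym M)"
  shows "foldr read as [] = map (inv (bit_sym M)) (takeWhile (\<lambda>a. a \<noteq> blank M) as)"
  using assms by (induction as) (auto simp: read_def)

lemma read_output:
  fixes t :: "nat \<Rightarrow> 'a"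
  defines "b \<equiv> LEAST m. 1 \<le> m \<and> t m = blank M"
  assumes rep: "zrep M (q, t, h) (q', ls, rs)" and bits: "set (map t [1..<b]) \<subseteq> range (bit_sym M)"
  shows "foldr read (tl (rev ls @ rs)) [] = map (inv (bit_sym M)) (map t [1..<b])"
proof -
  \<comment> \<open>From \<open>m\<close> on the represented tape is blank. The maximum with 1
    covers a zipper with both lists empty, which can occur when the end marker equals the
    blank.\<close>
  define m where "m = max 1 (h + length rs)"
  have ls: "ls = map t (rev [0..<h])" and rs: "\<And>j. t (h + j) = nth_default (blank M) rs j"
    using rep by (auto simp: zrep_def)
  have "rs = map t [h..<h + length rs]"
    by (rule nth_equalityI) (auto simp: rs nth_default_def)
  then have "rev ls @ rs = map t ([0..<h] @ [h..<h + length rs])"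
    by (simp add: ls rev_map)
  also have "\<dots> = map t [0..<h + length rs]"
    using upt_add_eq_append[of 0 h "length rs"] by simp
  finally have tape: "tl (rev ls @ rs) = map t [1..<m]"
    by (cases "h + length rs") (simp_all add: m_def flip: map_tl)
  \<comment> \<open>This blank shows that the least position defining \<open>b\<close> exists and is
    at most \<open>m\<close>.\<close>
  have tm: "t m = blank M"
    using rs[of "m - h"] by (auto simp: m_def nth_default_def max_def split: if_splits)
  have m: "1 \<le> m" by (simp add: m_def)
  have b: "1 \<le> b \<and> t b = blank M"
    unfolding b_def by (rule LeastI) (use m tm in blast)
  have bm: "b \<le> m" unfolding b_def by (rule Least_le) (use m tm in blast)
  have nb: "t i \<noteq> blank M" if "1 \<le> i" "i < b" for i
    using not_less_Least[of i "\<lambda>m. 1 \<le> m \<and> t m = blank M"] that by (auto simp: b_def)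
  have "takeWhile (\<lambda>a. a \<noteq> blank M) (map t [1..<m]) = map t [1..<b]"
  proof -
    have "[1..<m] = [1..<b] @ [b..<m]" using b bm upt_add_eq_append[of 1 b "m - b"] by simp
    moreover have "takeWhile (\<lambda>a. a \<noteq> blank M) (map t [b..<m]) = []"
      using b bm by (cases "b < m") (auto simp: upt_conv_Cons)
    moreover have "takeWhile (\<lambda>a. a \<noteq> blank M) (map t [1..<b] @ as) =
        map t [1..<b] @ takeWhile (\<lambda>a. a \<noteq> blank M) as" for as
      by (rule takeWhile_append2) (use nb in auto)
    ultimately show ?thesis by simp
  qed
  then show ?thesis
    using foldr_read[of "map t [1..<m]"] bits tape by auto
qed

end

text \<open>In the final state \<open>zstep\<close> at most appends a blank to \<open>rs\<close>,
  and the default value in \<open>zrep\<close> absorbs it.\<close>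

lemma zrep_final:
  assumes "zrep M (final M, t, h) z"
  shows "zrep M (final M, t, h) (zstep M z)"
proof -
  obtain ls rs where z: "z = (final M, ls, rs)" and rs: "\<And>j. t (h + j) = nth_default (blank M) rs j"
    using assms by (cases z) (auto simp: zrep_def)
  have "t (h + j) = nth_default (blank M) ((case rs of [] \<Rightarrow> blank M | a # _ \<Rightarrow> a) # tl rs) j" for j
    using rs[of j] by (cases rs; cases j) auto
  then show ?thesis using assms by (simp add: z zrep_def zstep_def Let_def)
qed

section \<open>Correctness, cost and annotated type together\<close>

theorem theorem2:
  fixes M :: "('q, 'a) tm"
  assumes "turing_machine M" and "poly_time M" and "outputs_bits M"
  shows "\<exists>M'. simple_typing Map.empty M' (SArrow s_bits s_bits) \<and>
    (\<forall>w. \<exists>k. eval_on M' (enc_bits w) (enc_bits (tm_fun M w)) k) \<and>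
    (\<forall>w v k. eval_on M' (enc_bits w) v k \<longrightarrow> of_nat (running_time M w) \<le> k) \<and>
    (\<exists>q b' c c'. (\<forall>r\<in>set q. 0 \<le> r) \<and> nonneg b' \<and> 0 \<le> c \<and> 0 \<le> c' \<and> erase b' = s_bits \<and>
       has_arrow_type M' (Arrow (AList q (ASum AUnit AUnit), c) (b', c')))"
proof -
  interpret compiler M by unfold_locales (rule assms)
  obtain p :: "nat poly" where halts: "\<And>w. tm_halts M w"
    and p: "\<And>w. running_time M w \<le> poly p (length w)"
    using assms(2) by (auto simp: poly_time_def)
  \<comment> \<open>The polynomial time bound of \<open>M\<close> fixes the tick constant and the
    nesting depth for all inputs at once.\<close>
  obtain N k where "\<And>n. poly p n \<le> N * iters k n"
    using poly_le_iters[of p] by blast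
  with p have time: "running_time M w \<le> N * iters k (length w)" for w
    using le_trans by blast
  have rep: "zrep M (tm_config M w n) ((zstep M ^^ n) (start_zipper w))"
    if "n \<le> running_time M w" for w n
    using that
  proof (induction n)
    case 0
    have "nth_default (blank M) (map (bit_sym M) w) j
        = (if j < length w then bit_sym M (w ! j) else blank M)" for j
      by (auto simp: nth_default_def)
    then show ?case by (auto simp: zrep_def tm_config_def tm_init_def)
  next
    case (Suc n)
    obtain q t h where c: "tm_config M w n = (q, t, h)" by (cases "tm_config M w n")
    \<comment> \<open>The running time is the least halting time, so the machine is still running at
      step \<open>n\<close>.\<close>
    have "fst (tm_config M w n) \<noteq> final M"
      using Suc.prems not_less_Least[of n "\<lambda>n. fst (tm_config M w n) = final M"]
      by (auto simp: running_time_def)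
    moreover have "q \<in> states M"
      using Suc zsteps_closed[of n w] by (auto simp: c zrep_def zippers_def)
    ultimately show ?case
      using zstep_tm_step[OF assms(1), of q t h] Suc c by (simp add: tm_config_def)
  qed
  \<comment> \<open>Surplus iterations keep representing the halting configuration, so any number of
    steps from the running time on yields the right output.\<close>
  have rep_final: "zrep M (tm_config M w (running_time M w)) ((zstep M ^^ n) (start_zipper w))"
    if "running_time M w \<le> n" for w n
    using that
  proof (induction n rule: dec_induct)
    case base
    show ?case by (rule rep) simp
  next
    case (step n)
    have "fst (tm_config M w (running_time M w)) = final M"
      using halts[of w] unfolding tm_halts_def running_time_def by (rule LeastI_ex)
    then obtain t h where "tm_config M w (running_time M w) = (final M, t, h)"
      by (metis prod.collapse)
    with step.IH show ?case by (simp add: zrep_final)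
  qed
  have eval: "eval_on (program N k) (enc_bits w) (enc_bits (tm_fun M w))
      (of_nat (N * iters k (length w)))" for w
  proof -
    obtain q t h where c: "tm_config M w (running_time M w) = (q, t, h)"
      by (cases "tm_config M w (running_time M w)")
    obtain q' ls rs where z: "(zstep M ^^ (N * iters k (length w))) (start_zipper w) = (q', ls, rs)"
      by (cases "(zstep M ^^ (N * iters k (length w))) (start_zipper w)")
    have "zrep M (q, t, h) (q', ls, rs)"
      using rep_final[OF time[of w]] by (simp add: c z)
    then have "foldr read (tl (rev ls @ rs)) [] = tm_fun M w"
      using read_output[of q t h q' ls rs] assms(3)[unfolded outputs_bits_def, rule_format, of w]
      by (simp add: tm_fun_def tm_output_def c Let_def)
    with eval_program[OF z] show ?thesis by simp
  qed
  have cost: "of_nat (running_time M w) \<le> c" if "eval_on (program N k) (enc_bits w) v c" for w v c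
  proof -
    \<comment> \<open>Determinism applies to both phases of \<open>eval_on\<close>; injectivity of
      \<open>VClosure\<close>, which is \<open>val.inject(5)\<close>, identifies the closures in
      between.\<close>
    have "c = of_nat (N * iters k (length w))"
      using that eval[of w] unfolding eval_on_def
      by (metis eval_deterministic val.inject(5))
    then show ?thesis using time[of w] by (simp only: of_nat_le_iff)
  qed
  have "erase_aty (Funs {Arrow (AList (replicate k (of_nat N)) (fty 1), of_nat N) (AList [] (fty 1), 0)})
      = SArrow s_bits s_bits"
    by simp
  then have "simple_typing Map.empty (program N k) (SArrow s_bits s_bits)"
    using simple_typing_erase[OF aara_program[of N k]] by (simp only: erase_ctx_empty)
  moreover have "has_arrow_type (program N k)
      (Arrow (AList (replicate k (of_nat N)) (ASum AUnit AUnit), of_nat N) (AList [] (fty 1), 0))"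
    unfolding has_arrow_type_def using aara_program[of N k] by fastforce
  then have "\<exists>q b' c c'. (\<forall>r\<in>set q. 0 \<le> r) \<and> nonneg b' \<and> 0 \<le> c \<and> 0 \<le> c' \<and>
      erase b' = s_bits \<and>
      has_arrow_type (program N k) (Arrow (AList q (ASum AUnit AUnit), c) (b', c'))"
    by (intro exI[of _ "replicate k (of_nat N)"] exI[of _ "AList [] (fty 1)"] exI[of _ "of_nat N"]
        exI[of _ 0]) auto
  ultimately show ?thesis using eval cost by blast
qed

end
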